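(* Let $K$ be a field of characteristic $p>0$ and let $\Gamma\subseteq\mathbb{R}$ be an additive subgroup such that $\Gamma/p\Gamma$ is infinite. Let $M=K((t^{p\Gamma}))\cdot K(t^\Gamma)\subseteq K((t^\Gamma))$ be the compositum, with the norm induced from $K((t^\Gamma))$. Then: (i) there is a bounded sequence $(r_i)_{i\ge0}$ of elements of $\Gamma$ lying in pairwise distinct cosets of $p\Gamma$; (ii) $M$ is an algebraic extension of $K((t^{p\Gamma}))$ and consists exactly of those Hahn series in $K((t^\Gamma))$ whose exponents lie in finitely many cosets of $p\Gamma$ in $\Gamma$; (iii) the completion $\widehat M$ of $M$ is not spherically complete; (iv) there is no nonzero continuous $\widehat M$-linear map $\widehat M^{1/p}\to\widehat M$.
   Context: For a field $K$ and an additive subgroup $\Gamma\subseteq\mathbb{R}$: $K[t^\Gamma]$ is the ring of finite sums $\sum_{\gamma\in\Gamma}a_\gamma t^\gamma$ ($a_\gamma\in K$), $K(t^\Gamma)$ its fraction field, and $K((t^\Gamma))$ the Hahn series field of formal sums $\sum_{\gamma\in\Gamma}a_\gamma t^\gamma$ whose support $\{\gamma: a_\gamma\ne0\}$ is well-ordered, with the usual multiplication. These are valued by $\|\sum a_\gamma t^\gamma\|=\max_{a_\gamma\neq0}e^{-\gamma}$ (and $\|0\|=0$), a non-Archimedean absolute value; $K(t^\Gamma)\subseteq K((t^\Gamma))$ compatibly, and $K((t^{p\Gamma}))\subseteq K((t^\Gamma))$. A complete valued field is spherically complete if every decreasing sequence of closed disks has nonempty intersection. $\widehat M^{1/p}$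 carries the unique absolute value extending that of $\widehat M$; continuity refers to metric topologies. *)

theory Defs
  imports Complex_Main
begin

text \<open>Hahn series over a field K with real exponents are represented as functions
  real \<Rightarrow> K (coefficient of t^x at x); K((t^G)) is the set of such functions with
  support contained in G and well-ordered.\<close>

definition hsupp :: "(real \<Rightarrow> 'a::zero) \<Rightarrow> real set" where
  "hsupp f = {x. f x \<noteq> 0}"

definition well_ordered_set :: "real set \<Rightarrow> bool" where
  "well_ordered_set S \<longleftrightarrow> (\<forall>A. A \<subseteq> S \<and> A \<noteq> {} \<longrightarrow> (\<exists>m\<in>A. \<forall>a\<in>A. m \<le> a))"

definition Hahn :: "real set \<Rightarrow> (real \<Rightarrow> 'a::zero) set" where
  "Hahn G = {f. hsupp f \<subseteq> G \<and> well_ordered_set (hsupp f)}"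

definition hzero :: "real \<Rightarrow> 'a::zero" where "hzero = (\<lambda>_. 0)"
definition hone :: "real \<Rightarrow> 'a::{zero,one}" where "hone = (\<lambda>x. if x = 0 then 1 else 0)"
definition hadd :: "(real \<Rightarrow> 'a::plus) \<Rightarrow> (real \<Rightarrow> 'a) \<Rightarrow> real \<Rightarrow> 'a" where
  "hadd f g = (\<lambda>x. f x + g x)"
definition hneg :: "(real \<Rightarrow> 'a::uminus) \<Rightarrow> real \<Rightarrow> 'a" where
  "hneg f = (\<lambda>x. - f x)"
definition hsub :: "(real \<Rightarrow> 'a::minus) \<Rightarrow> (real \<Rightarrow> 'a) \<Rightarrow> real \<Rightarrow> 'a" where
  "hsub f g = (\<lambda>x. f x - g x)"

text \<open>Cauchy product of Hahn series (the index set is finite for well-ordered supports).\<close>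
definition hmul :: "(real \<Rightarrow> 'a::comm_ring_1) \<Rightarrow> (real \<Rightarrow> 'a) \<Rightarrow> real \<Rightarrow> 'a" where
  "hmul f g = (\<lambda>c. \<Sum>a\<in>{a. f a \<noteq> 0 \<and> g (c - a) \<noteq> 0}. f a * g (c - a))"

fun hpow :: "(real \<Rightarrow> 'a::comm_ring_1) \<Rightarrow> nat \<Rightarrow> real \<Rightarrow> 'a" where
  "hpow f 0 = hone"
| "hpow f (Suc n) = hmul f (hpow f n)"

definition hnorm :: "(real \<Rightarrow> 'a::zero) \<Rightarrow> real" where
  "hnorm f = (if hsupp f = {} then 0 else exp (- (LEAST x. x \<in> hsupp f)))"

definition Hpoly :: "real set \<Rightarrow> (real \<Rightarrow> 'a::zero) set" where
  "Hpoly G = {f. finite (hsupp f) \<and> hsupp f \<subseteq> G}"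

definition Hrat :: "real set \<Rightarrow> (real \<Rightarrow> 'a::field) set" where
  "Hrat G = {f \<in> Hahn G. \<exists>P\<in>Hpoly G. \<exists>Q\<in>Hpoly G. Q \<noteq> hzero \<and> hmul Q f = P}"

definition scaleset :: "nat \<Rightarrow> real set \<Rightarrow> real set" where
  "scaleset p G = (\<lambda>x. real p * x) ` G"

definition is_subgroup_R :: "real set \<Rightarrow> bool" where
  "is_subgroup_R G \<longleftrightarrow> 0 \<in> G \<and> (\<forall>x\<in>G. \<forall>y\<in>G. x + y \<in> G) \<and> (\<forall>x\<in>G. - x \<in> G)"

definition cosets_R :: "real set \<Rightarrow> real set \<Rightarrow> real set set" where
  "cosets_R G H = (\<lambda>x. {x + h | h. h \<in> H}) ` G"

definition Hsubfield :: "real set \<Rightarrow> (real \<Rightarrow> 'a::field) set \<Rightarrow> bool" where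
  "Hsubfield G S \<longleftrightarrow> S \<subseteq> Hahn G \<and> hzero \<in> S \<and> hone \<in> S
     \<and> (\<forall>f\<in>S. \<forall>g\<in>S. hadd f g \<in> S \<and> hmul f g \<in> S) \<and> (\<forall>f\<in>S. hneg f \<in> S)
     \<and> (\<forall>f\<in>S. f \<noteq> hzero \<longrightarrow> (\<exists>g\<in>S. hmul f g = hone))"

definition Hcompositum :: "real set \<Rightarrow> (real \<Rightarrow> 'a::field) set \<Rightarrow> (real \<Rightarrow> 'a) set \<Rightarrow> (real \<Rightarrow> 'a) set" where
  "Hcompositum G A B = \<Inter>{S. Hsubfield G S \<and> A \<union> B \<subseteq> S}"

definition Halgebraic :: "(real \<Rightarrow> 'a::field) set \<Rightarrow> (real \<Rightarrow> 'a) \<Rightarrow> bool" where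
  "Halgebraic L f \<longleftrightarrow> (\<exists>n c. (\<forall>i\<le>n. c i \<in> L) \<and> (\<exists>i\<le>n. c i \<noteq> hzero)
      \<and> (\<lambda>x. \<Sum>i\<le>n. hmul (c i) (hpow f i) x) = hzero)"

text \<open>Closure of S in K((t^G)) for the metric d(f,g) = \<parallel>f - g\<parallel>; since K((t^G)) is
  complete this is (a model of) the completion of S.\<close>
definition Hclosure :: "real set \<Rightarrow> (real \<Rightarrow> 'a::field) set \<Rightarrow> (real \<Rightarrow> 'a) set" where
  "Hclosure G S = {f \<in> Hahn G. \<forall>\<epsilon>>0. \<exists>m\<in>S. hnorm (hsub f m) < \<epsilon>}"

definition Hdisk :: "(real \<Rightarrow> 'a::field) set \<Rightarrow> (real \<Rightarrow> 'a) \<Rightarrow> real \<Rightarrow> (real \<Rightarrow> 'a) set" where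
  "Hdisk S c r = {x \<in> S. hnorm (hsub x c) \<le> r}"

definition Hspherically_complete :: "(real \<Rightarrow> 'a::field) set \<Rightarrow> bool" where
  "Hspherically_complete S \<longleftrightarrow>
     (\<forall>c r. (\<forall>n. c n \<in> S \<and> 0 < r n) \<and> (\<forall>n. Hdisk S (c (Suc n)) (r (Suc n)) \<subseteq> Hdisk S (c n) (r n))
        \<longrightarrow> (\<Inter>n. Hdisk S (c n) (r n)) \<noteq> {})"

text \<open>Model of F^{1/p} for a subfield F of characteristic p: the Frobenius y \<mapsto> y^p is an
  isomorphism F^{1/p} \<cong> F. Transporting the structure, F^{1/p} has carrier F, the
  F-scalar action a \<cdot> y = a^p y and absolute value \<parallel>y\<parallel>^{1/p}.\<close>
definition root_smul :: "nat \<Rightarrow> (real \<Rightarrow> 'a::field) \<Rightarrow> (real \<Rightarrow> 'a) \<Rightarrow> real \<Rightarrow> 'a" where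
  "root_smul p a y = hmul (hpow a p) y"

definition root_norm :: "nat \<Rightarrow> (real \<Rightarrow> 'a::field) \<Rightarrow> real" where
  "root_norm p y = hnorm y powr (1 / real p)"

definition root_dual_map :: "nat \<Rightarrow> (real \<Rightarrow> 'a::field) set \<Rightarrow> ((real \<Rightarrow> 'a) \<Rightarrow> (real \<Rightarrow> 'a)) \<Rightarrow> bool" where
  "root_dual_map p F \<psi> \<longleftrightarrow>
     (\<forall>y\<in>F. \<psi> y \<in> F)
   \<and> (\<forall>x\<in>F. \<forall>y\<in>F. \<psi> (hadd x y) = hadd (\<psi> x) (\<psi> y))
   \<and> (\<forall>a\<in>F. \<forall>y\<in>F. \<psi> (root_smul p a y) = hmul a (\<psi> y))
   \<and> (\<forall>x\<in>F. \<forall>\<epsilon>>0. \<exists>\<delta>>0. \<forall>y\<in>F. root_norm p (hsub y x) < \<delta> \<longrightarrow> hnorm (hsub (\<psi> y) (\<psi> x)) < \<epsilon>)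
   \<and> (\<exists>y\<in>F. \<psi> y \<noteq> hzero)"

end

theory Submission
  imports Defs "HOL-Computational_Algebra.Primes"
begin

text \<open>
  Since exponents are real, a geometric series in a Hahn series of positive order converges, and
  Hahn series form a field. By the freshman's dream, the \<open>p\<close>-th power of a series supported on
  \<open>G\<close> is supported on \<open>pG\<close>; hence the series supported on finitely many cosets of \<open>pG\<close> form a
  field that is algebraic over \<open>K((t\<^sup>p\<^sup>G))\<close>, and this field is \<open>M\<close>. An element of the
  completion of \<open>M\<close> has exponents in only finitely many cosets below any bound. Therefore, for a
  bounded increasing sequence \<open>s\<close> of elements in distinct cosets, the partial sums of
  \<open>\<Sum>i. t^(s i)\<close> form a pseudo-Cauchy sequence without pseudo-limit, and the completion is not
  spherically complete. On the other hand its \<open>p\<close>-th root is a union of multiples of the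
  \<open>p\<close>-th root of \<open>K((t\<^sup>p\<^sup>G))\<close>, which is spherically complete; a nonzero continuous functional
  on such a multiple would map some pseudo-convergent sequence with a limit onto the partial sums
  above.
\<close>

section \<open>Well-ordered sets of reals\<close>

lemma well_ordered_setD:
  assumes "well_ordered_set S" "A \<subseteq> S" "A \<noteq> {}"
  obtains m where "m \<in> A" "\<And>a. a \<in> A \<Longrightarrow> m \<le> a"
proof -
  have "\<exists>m\<in>A. \<forall>a\<in>A. m \<le> a"
    using assms unfolding well_ordered_set_def by simp
  then show ?thesis using that by blast
qed

lemma well_ordered_set_subset:
  "well_ordered_set S \<Longrightarrow> T \<subseteq> S \<Longrightarrow> well_ordered_set T"
  unfolding well_ordered_set_def by blast

text \<open>A minimum of the part of \<open>A\<close> below one of its elements is a minimum of all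
  of \<open>A\<close>. This serves limits that agree with a single series only below each given
  exponent.\<close>

lemma well_ordered_set_locally:
  assumes "\<And>x. x \<in> S \<Longrightarrow> \<exists>T. well_ordered_set T \<and> {y \<in> S. y \<le> x} \<subseteq> T"
  shows "well_ordered_set S"
  unfolding well_ordered_set_def
proof (intro allI impI)
  fix A assume A: "A \<subseteq> S \<and> A \<noteq> {}"
  then obtain x where x: "x \<in> A" by blast
  with A obtain T where T: "well_ordered_set T" "{y \<in> S. y \<le> x} \<subseteq> T"
    using assms by blast
  have "{y \<in> A. y \<le> x} \<subseteq> T" "{y \<in> A. y \<le> x} \<noteq> {}" using T A x by auto
  from well_ordered_setD[OF T(1) this]
  obtain m where m: "m \<in> {y \<in> A. y \<le> x}" "\<And>a. a \<in> {y \<in> A. y \<le> x} \<Longrightarrow> m \<le> a"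
    by blast
  have "m \<le> a" if "a \<in> A" for a
    using m that by (cases "a \<le> x") auto
  with m show "\<exists>m\<in>A. \<forall>a\<in>A. m \<le> a" by blast
qed

lemma finite_imp_well_ordered_set: "finite S \<Longrightarrow> well_ordered_set S"
  unfolding well_ordered_set_def by (metis Min_in Min_le finite_subset)

lemma well_ordered_set_Un:
  assumes A: "well_ordered_set A" and B: "well_ordered_set B"
  shows "well_ordered_set (A \<union> B)"
  unfolding well_ordered_set_def
proof (intro allI impI)
  fix S assume S: "S \<subseteq> A \<union> B \<and> S \<noteq> {}"
  show "\<exists>m\<in>S. \<forall>a\<in>S. m \<le> a"
  proof (cases "S \<inter> A = {} \<or> S \<inter> B = {}")
    case True
    then have "S \<subseteq> A \<or> S \<subseteq> B" using S by blast
    then show ?thesis using A B S unfolding well_ordered_set_def by blast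
  next
    case False
    obtain a where a: "a \<in> S \<inter> A" "\<And>x. x \<in> S \<inter> A \<Longrightarrow> a \<le> x"
      using well_ordered_setD[OF A, of "S \<inter> A"] False by blast
    obtain b where b: "b \<in> S \<inter> B" "\<And>x. x \<in> S \<inter> B \<Longrightarrow> b \<le> x"
      using well_ordered_setD[OF B, of "S \<inter> B"] False by blast
    have "min a b \<in> S" using a b by (auto simp: min_def)
    moreover have "min a b \<le> x" if "x \<in> S" for x
      using a(2)[of x] b(2)[of x] that S by (auto simp: min_le_iff_disj)
    ultimately show ?thesis by blast
  qed
qed

text \<open>A minimal counterexample argument. A set of pairs is bad if its sums have no minimum;
  \<open>T\<close> collects the second coordinates of leftmost pairs of bad sets, and its least
  element leads to a contradiction.\<close>

lemma well_ordered_set_plus: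
  assumes A: "well_ordered_set A" and B: "well_ordered_set B"
  shows "well_ordered_set {a + b | a b. a \<in> A \<and> b \<in> B}"
proof -
  define bad where "bad S \<longleftrightarrow> S \<subseteq> A \<times> B \<and> S \<noteq> {} \<and>
    (\<forall>m\<in>S. \<exists>x\<in>S. fst x + snd x < fst m + snd m)" for S
  define T where "T = {b \<in> B. \<exists>S a. bad S \<and> (a, b) \<in> S \<and> (\<forall>x\<in>S. a \<le> fst x)}"
  have leftmost: "\<exists>b\<in>T. \<exists>a. (a, b) \<in> S" if "bad S" for S
  proof -
    from that have "fst ` S \<subseteq> A" "fst ` S \<noteq> {}" unfolding bad_def by auto
    then obtain a where a: "a \<in> fst ` S" "\<And>x. x \<in> fst ` S \<Longrightarrow> a \<le> x"
      using well_ordered_setD[OF A] by blast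
    then obtain b where ab: "(a, b) \<in> S" by auto
    then have "b \<in> T" using a(2) that unfolding T_def bad_def by auto
    then show ?thesis using ab by blast
  qed
  have no_bad: "\<not> bad S" for S
  proof
    assume "bad S"
    then have "T \<noteq> {}" using leftmost by blast
    moreover have "T \<subseteq> B" unfolding T_def by blast
    ultimately obtain b where b: "b \<in> T" "\<And>x. x \<in> T \<Longrightarrow> b \<le> x"
      using well_ordered_setD[OF B] by blast
    then obtain S a where S: "bad S" "(a, b) \<in> S" "\<forall>x\<in>S. a \<le> fst x"
      unfolding T_def by blast
    \<comment> \<open>Cutting a bad set at the sum \<open>a + b\<close> leaves a bad set. Its
      leftmost pair has first coordinate at least \<open>a\<close>, hence second coordinate below
      \<open>b\<close>, against the minimality of \<open>b\<close>.\<close>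
    define S' where "S' = {x \<in> S. fst x + snd x < a + b}"
    have "bad S'"
      unfolding bad_def
    proof (intro conjI ballI)
      show "S' \<subseteq> A \<times> B" "S' \<noteq> {}"
        using S unfolding bad_def S'_def by fastforce+
      fix m assume m: "m \<in> S'"
      then obtain x where "x \<in> S" "fst x + snd x < fst m + snd m"
        using S(1) unfolding bad_def S'_def by blast
      then show "\<exists>x\<in>S'. fst x + snd x < fst m + snd m"
        using m unfolding S'_def by (intro bexI[of _ x]) auto
    qed
    then obtain b' a' where b': "b' \<in> T" "(a', b') \<in> S'" using leftmost by blast
    then have "a' + b' < a + b" "a \<le> a'" using S(3) unfolding S'_def by auto
    then show False using b(2)[OF b'(1)] by simp
  qed
  show ?thesis
    unfolding well_ordered_set_def
  proof (intro allI impI)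
    fix S assume S: "S \<subseteq> {a + b | a b. a \<in> A \<and> b \<in> B} \<and> S \<noteq> {}"
    define S' where "S' = {x \<in> A \<times> B. fst x + snd x \<in> S}"
    have "S' \<subseteq> A \<times> B" "S' \<noteq> {}" using S unfolding S'_def by fastforce+
    with no_bad[of S'] obtain m where m: "m \<in> S'" "\<forall>x\<in>S'. fst m + snd m \<le> fst x + snd x"
      unfolding bad_def by (meson not_less)
    have "fst m + snd m \<le> s" if "s \<in> S" for s
    proof -
      from that S obtain a b where "s = a + b" "a \<in> A" "b \<in> B" by blast
      then show ?thesis using m(2) that unfolding S'_def by force
    qed
    then show "\<exists>m\<in>S. \<forall>a\<in>S. m \<le> a" using m(1) unfolding S'_def by blast
  qed
qed

lemma in_sumsetI:
  fixes a c :: real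
  assumes "a \<in> A" "c - a \<in> B"
  shows "c \<in> {a + b | a b. a \<in> A \<and> b \<in> B}"
proof -
  have "c = a + (c - a)" by simp
  then show ?thesis using assms by blast
qed

text \<open>Reflection turns minima into maxima, so every nonempty subset of \<open>X\<close> has
  both. If some initial segment were infinite, there would be a least \<open>m\<close> bounding an
  infinite one, but the largest element below \<open>m\<close> would bound an infinite one
  already.\<close>

lemma finite_if_well_ordered_both_ways:
  assumes X: "well_ordered_set X" and X': "well_ordered_set ((\<lambda>x. c - x) ` X)"
  shows "finite X"
proof -
  have max: "\<exists>m\<in>Y. \<forall>y\<in>Y. y \<le> m" if "Y \<subseteq> X" "Y \<noteq> {}" for Y
  proof -
    obtain m where "m \<in> (\<lambda>x. c - x) ` Y" "\<And>y. y \<in> (\<lambda>x. c - x) ` Y \<Longrightarrow> m \<le> y"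
      using well_ordered_setD[OF X', of "(\<lambda>x. c - x) ` Y"] \<open>Y \<subseteq> X\<close> \<open>Y \<noteq> {}\<close> by blast
    then show ?thesis by force
  qed
  have fin: "finite {y \<in> X. y \<le> x}" if "x \<in> X" for x
  proof (rule ccontr)
    assume "infinite {y \<in> X. y \<le> x}"
    define Z where "Z = {x \<in> X. infinite {y \<in> X. y \<le> x}}"
    have "Z \<subseteq> X" "Z \<noteq> {}" using that \<open>infinite _\<close> unfolding Z_def by blast+
    from well_ordered_setD[OF X this]
    obtain m where mZ: "m \<in> Z" "\<And>z. z \<in> Z \<Longrightarrow> m \<le> z" by blast
    then have m: "m \<in> X" "infinite {y \<in> X. y \<le> m}"
      "\<And>z. z \<in> X \<Longrightarrow> infinite {y \<in> X. y \<le> z} \<Longrightarrow> m \<le> z"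
      unfolding Z_def by simp_all
    have eq: "{y \<in> X. y \<le> m} = insert m {y \<in> X. y < m}" using m(1) by auto
    then have inf: "infinite {y \<in> X. y < m}" using m(2) by simp
    then have "{y \<in> X. y < m} \<noteq> {}" by (metis finite.emptyI)
    with max[of "{y \<in> X. y < m}"]
    obtain t where t: "t \<in> X" "t < m" "\<And>y. y \<in> X \<Longrightarrow> y < m \<Longrightarrow> y \<le> t"
      by blast
    then have "{y \<in> X. y < m} \<subseteq> {y \<in> X. y \<le> t}" by blast
    moreover have "finite {y \<in> X. y \<le> t}" using m(3)[OF t(1)] t(2) by force
    ultimately show False using inf finite_subset by blast
  qed
  show ?thesis
  proof (cases "X = {}")
    case False
    then obtain m where "m \<in> X" "\<forall>y\<in>X. y \<le> m" using max by blast
    then have "X = {y \<in> X. y \<le> m}" by blast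
    then show ?thesis using fin[OF \<open>m \<in> X\<close>] by metis
  qed simp
qed

text \<open>This makes each coefficient of a Cauchy product a genuine finite sum; over an infinite
  index set the sum would default to 0.\<close>

lemma finite_well_ordered_sum_fibre:
  assumes "well_ordered_set A" "well_ordered_set B"
  shows "finite {a \<in> A. c - a \<in> B}"
proof (rule finite_if_well_ordered_both_ways)
  show "well_ordered_set {a \<in> A. c - a \<in> B}"
    by (rule well_ordered_set_subset[OF assms(1)]) blast
  show "well_ordered_set ((\<lambda>x. c - x) ` {a \<in> A. c - a \<in> B})"
    by (rule well_ordered_set_subset[OF assms(2)]) blast
qed

section \<open>The field of Hahn series with real exponents\<close>

text \<open>All real exponents are allowed, since a type cannot depend on the set \<open>G\<close>;
  having exponents in \<open>G\<close> becomes a condition on \<open>supp\<close>. The type gives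
  access to the algebraic type classes.\<close>

typedef (overloaded) 'a hahn = "Hahn UNIV :: (real \<Rightarrow> 'a::zero) set"
  morphisms coeff Abs_hahn
proof -
  have "hzero \<in> (Hahn UNIV :: (real \<Rightarrow> 'a) set)"
    by (auto simp: Hahn_def hsupp_def hzero_def intro!: finite_imp_well_ordered_set)
  then show ?thesis by blast
qed

abbreviation supp :: "'a::zero hahn \<Rightarrow> real set" where
  "supp f \<equiv> hsupp (coeff f)"

lemma well_ordered_supp: "well_ordered_set (supp f)"
  using coeff[of f] by (simp add: Hahn_def)

lemma in_supp_iff: "x \<in> supp f \<longleftrightarrow> coeff f x \<noteq> 0"
  by (simp add: hsupp_def)

lemma coeff_Abs_hahn: "well_ordered_set (hsupp f) \<Longrightarrow> coeff (Abs_hahn f) = f"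
  by (rule Abs_hahn_inverse) (simp add: Hahn_def)

lemma hahn_eqI: "(\<And>x. coeff f x = coeff g x) \<Longrightarrow> f = g"
  by (metis coeff_inject ext)

text \<open>The bridge from the sets of functions in the theorem to the type
  \<open>hahn\<close>.\<close>

lemma Hahn_eq_image_coeff: "Hahn H = coeff ` {f. supp f \<subseteq> H}" (is "?L = ?R")
proof
  show "?L \<subseteq> ?R"
  proof
    fix f assume f: "f \<in> ?L"
    then have "coeff (Abs_hahn f) = f" by (intro coeff_Abs_hahn) (simp add: Hahn_def)
    then show "f \<in> ?R"
      using f by (intro image_eqI[of _ _ "Abs_hahn f"]) (auto simp: Hahn_def)
  qed
qed (auto simp: Hahn_def well_ordered_supp)

instantiation hahn :: (ab_group_add) ab_group_add
begin

definition "0 = Abs_hahn hzero"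
definition "f + g = Abs_hahn (hadd (coeff f) (coeff g))"
definition "f - g = Abs_hahn (hsub (coeff f) (coeff g))"
definition "- f = Abs_hahn (hneg (coeff f))"

lemma coeff_zero_fun: "coeff 0 = hzero"
  unfolding zero_hahn_def
  by (rule coeff_Abs_hahn) (auto simp: hsupp_def hzero_def intro!: finite_imp_well_ordered_set)

lemma coeff_plus_fun: "coeff (f + g) = hadd (coeff f) (coeff g)"
  unfolding plus_hahn_def
  by (rule coeff_Abs_hahn, rule well_ordered_set_subset,
      rule well_ordered_set_Un[OF well_ordered_supp[of f] well_ordered_supp[of g]])
     (auto simp: hsupp_def hadd_def)

lemma coeff_minus_fun: "coeff (f - g) = hsub (coeff f) (coeff g)"
  unfolding minus_hahn_def
  by (rule coeff_Abs_hahn, rule well_ordered_set_subset,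
      rule well_ordered_set_Un[OF well_ordered_supp[of f] well_ordered_supp[of g]])
     (auto simp: hsupp_def hsub_def)

lemma coeff_uminus_fun: "coeff (- f) = hneg (coeff f)"
  unfolding uminus_hahn_def
  by (rule coeff_Abs_hahn, rule well_ordered_set_subset, rule well_ordered_supp[of f])
     (auto simp: hsupp_def hneg_def)

lemma coeff_zero [simp]: "coeff 0 x = 0"
  by (simp add: coeff_zero_fun hzero_def)

lemma coeff_plus [simp]: "coeff (f + g) x = coeff f x + coeff g x"
  by (simp add: coeff_plus_fun hadd_def)

lemma coeff_minus [simp]: "coeff (f - g) x = coeff f x - coeff g x"
  by (simp add: coeff_minus_fun hsub_def)

lemma coeff_uminus [simp]: "coeff (- f) x = - coeff f x"
  by (simp add: coeff_uminus_fun hneg_def)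

instance
proof
  fix f g h :: "'a hahn"
  show "f + g + h = f + (g + h)" by (rule hahn_eqI) (simp add: add.assoc)
  show "f + g = g + f" by (rule hahn_eqI) (simp add: add.commute)
  show "0 + f = f" by (rule hahn_eqI) simp
  show "- f + f = 0" by (rule hahn_eqI) simp
  show "f - g = f + - g" by (rule hahn_eqI) simp
qed

end

lemma coeff_sum [simp]: "coeff (sum f A) x = (\<Sum>i\<in>A. coeff (f i) x)"
  by (induction A rule: infinite_finite_induct) auto

section \<open>The Cauchy product and the ring of Hahn series\<close>

lemma finite_hmul_index:
  fixes f g :: "'a::comm_ring_1 hahn"
  shows "finite {a \<in> supp f. c - a \<in> supp g}"
  by (rule finite_well_ordered_sum_fibre) (rule well_ordered_supp)+

text \<open>Padding the index set with zero terms allows several products to be summed over one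
  common finite set.\<close>

lemma hmul_eq_sum:
  fixes f g :: "'a::comm_ring_1 hahn"
  assumes "finite S" "{a \<in> supp f. c - a \<in> supp g} \<subseteq> S"
  shows "hmul (coeff f) (coeff g) c = (\<Sum>a\<in>S. coeff f a * coeff g (c - a))"
  unfolding hmul_def using assms
  by (intro sum.mono_neutral_left) (auto simp: hsupp_def)

lemma hsupp_hmul_subset:
  fixes f g :: "real \<Rightarrow> 'a::comm_ring_1"
  shows "hsupp (hmul f g) \<subseteq> {a + b | a b. a \<in> hsupp f \<and> b \<in> hsupp g}"
proof
  fix c assume "c \<in> hsupp (hmul f g)"
  then have "(\<Sum>a\<in>{a. f a \<noteq> 0 \<and> g (c - a) \<noteq> 0}. f a * g (c - a)) \<noteq> 0"
    unfolding hsupp_def hmul_def by simp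
  then have "{a. f a \<noteq> 0 \<and> g (c - a) \<noteq> 0} \<noteq> {}"
    by (metis sum.empty)
  then obtain a where "f a \<noteq> 0" "g (c - a) \<noteq> 0" by blast
  then show "c \<in> {a + b | a b. a \<in> hsupp f \<and> b \<in> hsupp g}"
    by (intro in_sumsetI[of a]) (simp_all add: hsupp_def)
qed

definition monomial :: "'a::zero \<Rightarrow> real \<Rightarrow> 'a hahn" where
  "monomial a r = Abs_hahn (\<lambda>x. if x = r then a else 0)"

lemma coeff_monomial [simp]: "coeff (monomial a r) x = (if x = r then a else 0)"
proof -
  have "well_ordered_set (hsupp (\<lambda>x. if x = r then a else 0))"
    by (rule finite_imp_well_ordered_set, rule finite_subset[of _ "{r}"]) (auto simp: hsupp_def)
  then show ?thesis unfolding monomial_def by (simp add: coeff_Abs_hahn)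
qed

instantiation hahn :: (comm_ring_1) comm_ring_1
begin

definition "1 = monomial 1 0"
definition "f * g = Abs_hahn (hmul (coeff f) (coeff g))"

lemma coeff_one_fun: "coeff 1 = hone"
  unfolding one_hahn_def hone_def by (rule ext) simp

lemma coeff_times_fun: "coeff (f * g) = hmul (coeff f) (coeff g)"
  unfolding times_hahn_def
  by (rule coeff_Abs_hahn, rule well_ordered_set_subset[OF _ hsupp_hmul_subset])
     (intro well_ordered_set_plus well_ordered_supp)

lemma supp_times: "supp (f * g) \<subseteq> {a + b | a b. a \<in> supp f \<and> b \<in> supp g}"
  unfolding coeff_times_fun by (rule hsupp_hmul_subset)

lemma coeff_times_eq_sum:
  assumes "finite S" "{a \<in> supp f. c - a \<in> supp g} \<subseteq> S"
  shows "coeff (f * g) c = (\<Sum>a\<in>S. coeff f a * coeff g (c - a))"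
  unfolding coeff_times_fun using assms by (rule hmul_eq_sum)

lemma coeff_times:
  "coeff (f * g) c = (\<Sum>a\<in>{a \<in> supp f. c - a \<in> supp g}. coeff f a * coeff g (c - a))"
  by (rule coeff_times_eq_sum[OF finite_hmul_index order_refl])

lemma coeff_monomial_times [simp]: "coeff (monomial a r * f) x = a * coeff f (x - r)"
proof -
  have "supp (monomial a r) \<subseteq> {r}" by (auto simp: hsupp_def)
  then have "coeff (monomial a r * f) x = (\<Sum>y\<in>{r}. coeff (monomial a r) y * coeff f (x - y))"
    by (intro coeff_times_eq_sum) auto
  then show ?thesis by simp
qed

instance
proof
  fix f g h :: "'a hahn"
  show "f * g * h = f * (g * h)"
  proof (rule hahn_eqI)
    fix c
    \<comment> \<open>Both bracketings are sums over the triples of exponents adding up to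
      \<open>c\<close>. The outer index uses the sumsets \<open>AB\<close> and \<open>BC\<close>
      instead of the supports of the inner products, so cancellation in those does no harm.\<close>
    define AB where "AB = {a + b | a b. a \<in> supp f \<and> b \<in> supp g}"
    define BC where "BC = {a + b | a b. a \<in> supp g \<and> b \<in> supp h}"
    define I where "I = {d \<in> AB. c - d \<in> supp h}"
    define I' where "I' = {a \<in> supp f. c - a \<in> BC}"
    define J where "J d = {a \<in> supp f. d - a \<in> supp g}" for d
    define J' where "J' a = {b \<in> supp g. c - a - b \<in> supp h}" for a
    have fin: "finite I" "finite I'" "\<And>d. finite (J d)" "\<And>a. finite (J' a)"
      unfolding I_def I'_def J_def J'_def AB_def BC_def
      by (intro finite_well_ordered_sum_fibre well_ordered_set_plus well_ordered_supp)+
    have "coeff (f * g * h) c = (\<Sum>d\<in>I. coeff (f * g) d * coeff h (c - d))"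
      using supp_times[of f g] fin unfolding I_def AB_def
      by (intro coeff_times_eq_sum) auto
    also have "\<dots> = (\<Sum>d\<in>I. \<Sum>a\<in>J d. coeff f a * coeff g (d - a) * coeff h (c - d))"
      unfolding J_def by (simp add: coeff_times sum_distrib_right)
    also have "\<dots> = (\<Sum>(d, a)\<in>Sigma I J. coeff f a * coeff g (d - a) * coeff h (c - d))"
      using fin by (subst sum.Sigma) auto
    also have "\<dots> = (\<Sum>(a, b)\<in>Sigma I' J'. coeff f a * (coeff g b * coeff h (c - a - b)))"
    proof (rule sum.reindex_bij_witness[of _ "\<lambda>(a, b). (a + b, a)" "\<lambda>(d, a). (a, d - a)"])
      fix x assume "x \<in> Sigma I J"
      then obtain d a where x: "x = (d, a)" "c - d \<in> supp h" "a \<in> supp f" "d - a \<in> supp g"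
        unfolding I_def J_def by blast
      then have "c - a \<in> BC" 
        unfolding BC_def by (intro in_sumsetI[of "d - a"]) simp_all
      with x show "(case x of (d, a) \<Rightarrow> (a, d - a)) \<in> Sigma I' J'"
        unfolding I'_def J'_def by auto
    next
      fix y assume "y \<in> Sigma I' J'"
      then obtain a b where y: "y = (a, b)" "a \<in> supp f" "b \<in> supp g" "c - a - b \<in> supp h"
        unfolding I'_def J'_def by blast
      then show "(case y of (a, b) \<Rightarrow> (a + b, a)) \<in> Sigma I J"
        unfolding I_def J_def AB_def by (auto simp: diff_diff_eq)
    qed (auto simp: mult.assoc)
    also have "\<dots> = (\<Sum>a\<in>I'. \<Sum>b\<in>J' a. coeff f a * (coeff g b * coeff h (c - a - b)))"
      using fin by (subst sum.Sigma) auto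
    also have "\<dots> = (\<Sum>a\<in>I'. coeff f a * coeff (g * h) (c - a))"
      unfolding J'_def by (simp add: coeff_times sum_distrib_left)
    also have "\<dots> = coeff (f * (g * h)) c"
      using supp_times[of g h] fin unfolding I'_def BC_def
      by (intro coeff_times_eq_sum[symmetric]) auto
    finally show "coeff (f * g * h) c = coeff (f * (g * h)) c" .
  qed
  show "f * g = g * f"
    by (rule hahn_eqI, unfold coeff_times,
        rule sum.reindex_bij_witness[of _ "\<lambda>b. c - b" "\<lambda>b. c - b" for c])
       (auto simp: mult.commute)
  show "1 * f = f"
    unfolding one_hahn_def by (rule hahn_eqI) simp
  show "(f + g) * h = f * h + g * h"
  proof (rule hahn_eqI)
    fix c
    \<comment> \<open>A common index set for all three products; \<open>supp (f + g)\<close> itself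
      may miss exponents that cancel.\<close>
    define S where "S = {a \<in> supp f \<union> supp g. c - a \<in> supp h}"
    have "finite S"
      unfolding S_def
      by (intro finite_well_ordered_sum_fibre well_ordered_set_Un well_ordered_supp)
    moreover have "supp (f + g) \<subseteq> supp f \<union> supp g" by (auto simp: hsupp_def)
    ultimately have "coeff ((f + g) * h) c = (\<Sum>a\<in>S. coeff (f + g) a * coeff h (c - a))"
      "coeff (f * h) c = (\<Sum>a\<in>S. coeff f a * coeff h (c - a))"
      "coeff (g * h) c = (\<Sum>a\<in>S. coeff g a * coeff h (c - a))"
      by (intro coeff_times_eq_sum; force simp: S_def)+
    then show "coeff ((f + g) * h) c = coeff (f * h + g * h) c"
      by (simp add: sum.distrib distrib_right)
  qed
  have "coeff 0 0 \<noteq> coeff (1::'a hahn) 0"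
    unfolding one_hahn_def by simp
  then show "(0::'a hahn) \<noteq> 1" by metis
qed

end

section \<open>Supports and least exponents\<close>

lemma supp_zero [simp]: "supp (0::'a::ab_group_add hahn) = {}"
  by (simp add: hsupp_def)

lemma supp_eq_empty_iff [simp]: "supp f = {} \<longleftrightarrow> f = (0::'a::ab_group_add hahn)"
  by (auto simp: hsupp_def intro: hahn_eqI)

lemma supp_plus_subset: "supp f \<subseteq> A \<Longrightarrow> supp g \<subseteq> A \<Longrightarrow> supp (f + g) \<subseteq> A"
  for f g :: "'a::ab_group_add hahn"
  by (force simp: hsupp_def)

lemma supp_uminus [simp]: "supp (- f) = supp f" for f :: "'a::ab_group_add hahn"
  by (simp add: hsupp_def)

lemma supp_minus_subset: "supp f \<subseteq> A \<Longrightarrow> supp g \<subseteq> A \<Longrightarrow> supp (f - g) \<subseteq> A"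
  for f g :: "'a::ab_group_add hahn"
  by (force simp: hsupp_def)

lemma supp_sum_subset: "(\<And>i. i \<in> I \<Longrightarrow> supp (f i) \<subseteq> A) \<Longrightarrow> supp (sum f I) \<subseteq> A"
  for f :: "'i \<Rightarrow> 'a::ab_group_add hahn"
  by (induction I rule: infinite_finite_induct) (simp_all add: supp_plus_subset)

lemma supp_times_subset:
  fixes f g :: "'a::comm_ring_1 hahn"
  assumes "supp f \<subseteq> A" "supp g \<subseteq> B" "\<And>a b. a \<in> A \<Longrightarrow> b \<in> B \<Longrightarrow> a + b \<in> C"
  shows "supp (f * g) \<subseteq> C"
proof
  fix x assume "x \<in> supp (f * g)"
  then obtain a b where "x = a + b" "a \<in> supp f" "b \<in> supp g" using supp_times by blast
  then show "x \<in> C" using assms by blast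
qed

lemma supp_monomial_subset: "supp (monomial a r) \<subseteq> {r}"
  by (auto simp: hsupp_def)

lemma supp_one_subset: "supp (1::'a::comm_ring_1 hahn) \<subseteq> {0}"
  unfolding one_hahn_def by (rule supp_monomial_subset)

lemma supp_subset_atLeast:
  obtains x where "supp f \<subseteq> {x..}"
proof (cases "supp f = {}")
  case False
  from well_ordered_setD[OF well_ordered_supp order_refl this]
  show ?thesis using that by (metis atLeast_iff subsetI)
qed auto

text \<open>The exponent \<open>v\<close> is the valuation of \<open>f\<close>; it replaces the norm
  in all arguments inside the type.\<close>

lemma least_supp:
  fixes f :: "'a::ab_group_add hahn"
  assumes "f \<noteq> 0"
  obtains v where "coeff f v \<noteq> 0" "supp f \<subseteq> {v..}"
proof -
  have "supp f \<noteq> {}" using assms by simp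
  then obtain v where "v \<in> supp f" "\<And>x. x \<in> supp f \<Longrightarrow> v \<le> x"
    using well_ordered_setD[OF well_ordered_supp order_refl] by metis
  moreover from this have "supp f \<subseteq> {v..}" by auto
  ultimately show ?thesis using that[of v] by (simp add: in_supp_iff)
qed

definition restrict_supp :: "real set \<Rightarrow> 'a::zero hahn \<Rightarrow> 'a hahn" where
  "restrict_supp A f = Abs_hahn (\<lambda>x. if x \<in> A then coeff f x else 0)"

lemma coeff_restrict_supp [simp]: "coeff (restrict_supp A f) x = (if x \<in> A then coeff f x else 0)"
proof -
  have "well_ordered_set (hsupp (\<lambda>x. if x \<in> A then coeff f x else 0))"
    by (rule well_ordered_set_subset[OF well_ordered_supp[of f]]) (auto simp: hsupp_def)
  then show ?thesis unfolding restrict_supp_def by (simp add: coeff_Abs_hahn)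
qed

lemma supp_restrict_supp [simp]: "supp (restrict_supp A f) = supp f \<inter> A"
  by (auto simp: hsupp_def)

lemma monomial_power: "monomial a r ^ n = monomial (a ^ n) (real n * r)"
  for a :: "'a::comm_ring_1"
proof (induction n)
  case 0
  show ?case by (simp add: one_hahn_def)
next
  case (Suc n)
  show ?case unfolding power_Suc Suc.IH
    by (rule hahn_eqI) (auto simp: algebra_simps)
qed

lemma supp_power_subset:
  fixes f :: "'a::comm_ring_1 hahn"
  assumes "supp f \<subseteq> A" "0 \<in> A" "\<And>a b. a \<in> A \<Longrightarrow> b \<in> A \<Longrightarrow> a + b \<in> A"
  shows "supp (f ^ n) \<subseteq> A"
proof (induction n)
  case 0
  show ?case using supp_one_subset assms(2) by auto
next
  case (Suc n)
  show ?case unfolding power_Suc by (rule supp_times_subset[OF assms(1) Suc assms(3)])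
qed

lemma supp_power_atLeast:
  fixes f :: "'a::comm_ring_1 hahn"
  assumes "supp f \<subseteq> {x..}"
  shows "supp (f ^ n) \<subseteq> {real n * x..}"
proof (induction n)
  case 0
  show ?case using supp_one_subset by auto
next
  case (Suc n)
  show ?case unfolding power_Suc
    by (rule supp_times_subset[OF assms(1) Suc]) (simp add: algebra_simps)
qed

text \<open>Spherical completeness of the Hahn field, for closed disks around \<open>f n\<close> of
  radius \<open>exp (- \<tau> n)\<close>.\<close>

lemma pseudo_limit:
  fixes f :: "nat \<Rightarrow> 'a::ab_group_add hahn" and \<tau> :: "nat \<Rightarrow> real"
  assumes mono: "mono \<tau>" and step: "\<And>n. supp (f (Suc n) - f n) \<subseteq> {\<tau> n..}"
    and H: "\<And>n. supp (f n) \<subseteq> H"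
  obtains g where "\<And>n. supp (g - f n) \<subseteq> {\<tau> n..}" "supp g \<subseteq> H"
proof -
  have stable: "coeff (f m) x = coeff (f n) x" if "n \<le> m" "x < \<tau> n" for m n x
    using that(1)
  proof (induction m rule: dec_induct)
    case (step m)
    have "x < \<tau> m" using that(2) monoD[OF mono step(1)] by simp
    then have "x \<notin> supp (f (Suc m) - f m)" using assms(2)[of m] by auto
    then show ?case using step by (simp add: in_supp_iff)
  qed simp
  \<comment> \<open>The first stage whose threshold exceeds \<open>x\<close>, from which on the
    coefficient at \<open>x\<close> is stable. Exponents not below any threshold, which exist when
    \<open>\<tau>\<close> is bounded, get coefficient 0 so that the support stays
    well-ordered.\<close>
  define N where "N x = (LEAST n. x < \<tau> n)" for x
  define g where "g x = (if \<exists>n. x < \<tau> n then coeff (f (N x)) x else 0)" for x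
  have g: "g x = coeff (f n) x" if "x < \<tau> n" for x n
  proof -
    have "x < \<tau> (N x)" "N x \<le> n" using that unfolding N_def by (auto intro: LeastI Least_le)
    then show ?thesis using stable that unfolding g_def by auto
  qed
  have "well_ordered_set (hsupp g)"
  proof (rule well_ordered_set_locally)
    fix x assume "x \<in> hsupp g"
    then obtain n where n: "x < \<tau> n" unfolding hsupp_def g_def by (auto split: if_splits)
    have "{y \<in> hsupp g. y \<le> x} \<subseteq> supp (f n)"
    proof
      fix y assume "y \<in> {y \<in> hsupp g. y \<le> x}"
      then show "y \<in> supp (f n)" using g[of y n] n by (auto simp: hsupp_def)
    qed
    then show "\<exists>T. well_ordered_set T \<and> {y \<in> hsupp g. y \<le> x} \<subseteq> T"
      using well_ordered_supp by blast
  qed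
  then have coeff_g: "coeff (Abs_hahn g) = g" by (rule coeff_Abs_hahn)
  show ?thesis
  proof
    show "supp (Abs_hahn g - f n) \<subseteq> {\<tau> n..}" for n
    proof
      fix x assume "x \<in> supp (Abs_hahn g - f n)"
      then show "x \<in> {\<tau> n..}" using g[of x n] by (force simp: in_supp_iff coeff_g)
    qed
    show "supp (Abs_hahn g) \<subseteq> H"
    proof
      fix x assume "x \<in> supp (Abs_hahn g)"
      then have "x \<in> supp (f (N x))" unfolding coeff_g hsupp_def g_def by (auto split: if_splits)
      then show "x \<in> H" using H by blast
    qed
  qed
qed

section \<open>Inverses by geometric series\<close>

text \<open>A nonzero series would have a least exponent above all multiples of
  \<open>\<epsilon>\<close>, which the Archimedean property excludes.\<close>

lemma eq_zero_if_supp_unbounded: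
  fixes f :: "'a::ab_group_add hahn"
  assumes "\<And>n::nat. supp f \<subseteq> {real n * \<epsilon>..}" "\<epsilon> > 0"
  shows "f = 0"
proof (rule ccontr)
  assume "f \<noteq> 0"
  then obtain v where v: "coeff f v \<noteq> 0" using least_supp by blast
  obtain n where "v < real n * \<epsilon>" using reals_Archimedean3[OF assms(2)] by blast
  then show False using assms(1)[of n] v by (force simp: in_supp_iff)
qed

text \<open>Dividing by the leading term turns \<open>f\<close> into \<open>1 - h\<close> with
  \<open>h\<close> of positive order. The inverse of \<open>1 - h\<close> is the geometric series in
  \<open>h\<close>, a pseudo-limit of its partial sums, and everything stays inside the subgroup
  \<open>H\<close>.\<close>

lemma Hahn_inverse_exists:
  fixes f :: "'a::field hahn"
  assumes "f \<noteq> 0" and H: "is_subgroup_R H" and f: "supp f \<subseteq> H"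
  obtains g where "f * g = 1" "supp g \<subseteq> H"
proof -
  have H_plus: "a + b \<in> H" if "a \<in> H" "b \<in> H" for a b using H that by (simp add: is_subgroup_R_def)
  have H0: "0 \<in> H" using H by (simp add: is_subgroup_R_def)
  obtain v where v: "coeff f v \<noteq> 0" "supp f \<subseteq> {v..}" using least_supp[OF assms(1)] by blast
  define u where "u = monomial (inverse (coeff f v)) (- v)"
  define h where "h = 1 - u * f"
  have "v \<in> H" using v f by (auto simp: in_supp_iff)
  then have uH: "supp u \<subseteq> H"
    unfolding u_def using H
    by (intro order_trans[OF supp_monomial_subset]) (simp add: is_subgroup_R_def)
  have hH: "supp h \<subseteq> H"
    unfolding h_def using supp_one_subset H0
    by (intro supp_minus_subset supp_times_subset[OF uH f H_plus]) auto
  have h_pos: "x > 0" if "x \<in> supp h" for x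
  proof (rule ccontr)
    assume x: "\<not> x > 0"
    have "coeff h x = 0"
    proof (cases "x = 0")
      case True
      then show ?thesis using v(1) by (simp add: h_def u_def one_hahn_def)
    next
      case False
      then have "x + v < v" using x by simp
      then have "coeff f (x + v) = 0" using v(2) by (force simp: hsupp_def)
      then show ?thesis using False by (simp add: h_def u_def one_hahn_def)
    qed
    then show False using that by (simp add: in_supp_iff)
  qed
  \<comment> \<open>The least exponent of \<open>h\<close> if there is one; for \<open>h = 0\<close>
    any positive number serves, here 1.\<close>
  obtain \<epsilon> where \<epsilon>: "\<epsilon> > 0" "supp h \<subseteq> {\<epsilon>..}"
  proof (cases "h = 0")
    case True
    then show ?thesis using that[of 1] by simp
  next
    case False
    then show ?thesis using least_supp[of h] h_pos that by (metis in_supp_iff)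
  qed
  define s where "s n = (\<Sum>k<n. h ^ k)" for n
  have hn: "supp (h ^ n) \<subseteq> {real n * \<epsilon>..}" for n using supp_power_atLeast[OF \<epsilon>(2)] .
  have "mono (\<lambda>n. real n * \<epsilon>)" using \<epsilon>(1) by (intro monoI) (simp add: mult_right_mono)
  moreover have "supp (s (Suc n) - s n) \<subseteq> {real n * \<epsilon>..}" for n using hn by (simp add: s_def)
  moreover have "supp (s n) \<subseteq> H" for n
    unfolding s_def by (intro supp_sum_subset supp_power_subset hH H0 H_plus)
  ultimately obtain g where g: "\<And>n. supp (g - s n) \<subseteq> {real n * \<epsilon>..}" "supp g \<subseteq> H"
    using pseudo_limit[of "\<lambda>n. real n * \<epsilon>" s H] by blast
  \<comment> \<open>For every \<open>n\<close> the error equals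
    \<open>(1 - h) * (g - s n) - h ^ n\<close>, whose order is at least
    \<open>n * \<epsilon>\<close>.\<close>
  have "(1 - h) * g - 1 = 0"
  proof (rule eq_zero_if_supp_unbounded[OF _ \<epsilon>(1)])
    fix n
    have "(1 - h) * s n = 1 - h ^ n" unfolding s_def by (simp add: one_diff_power_eq)
    then have "(1 - h) * g - 1 = (1 - h) * (g - s n) - h ^ n" by (simp add: algebra_simps)
    moreover have "supp (1 - h) \<subseteq> {0..}"
      using supp_one_subset h_pos by (intro supp_minus_subset) force+
    then have "supp ((1 - h) * (g - s n)) \<subseteq> {real n * \<epsilon>..}"
      by (rule supp_times_subset[OF _ g(1)]) simp
    ultimately show "supp ((1 - h) * g - 1) \<subseteq> {real n * \<epsilon>..}"
      using supp_minus_subset[OF _ hn] by simp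
  qed
  then have "f * (u * g) = 1" unfolding h_def by (simp add: algebra_simps)
  moreover have "supp (u * g) \<subseteq> H" by (rule supp_times_subset[OF uH g(2) H_plus])
  ultimately show ?thesis using that by blast
qed

instantiation hahn :: (field) field
begin

text \<open>The choice is harmless because inverses in a commutative ring are unique.\<close>

definition "inverse (f::'a hahn) = (if f = 0 then 0 else SOME g. f * g = 1)"
definition "(f::'a hahn) div g = f * inverse g"

instance
proof
  fix f g :: "'a hahn"
  show "inverse f * f = 1" if "f \<noteq> 0"
  proof -
    have "is_subgroup_R UNIV" by (simp add: is_subgroup_R_def)
    from Hahn_inverse_exists[OF that this] have "\<exists>g. f * g = 1" by auto
    then have "f * inverse f = 1" using that 
      unfolding inverse_hahn_def by (simp add: someI_ex[of "\<lambda>g. f * g = 1"])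
    then show ?thesis by (simp add: mult.commute)
  qed
  show "f div g = f * inverse g" by (simp add: divide_hahn_def)
  show "inverse (0::'a hahn) = 0" by (simp add: inverse_hahn_def)
qed

end

text \<open>By uniqueness, the chosen inverse is the one constructed inside
  \<open>H\<close>.\<close>

lemma supp_inverse_subset:
  fixes f :: "'a::field hahn"
  assumes "is_subgroup_R H" "supp f \<subseteq> H"
  shows "supp (inverse f) \<subseteq> H"
proof (cases "f = 0")
  case False
  then obtain g where "f * g = 1" "supp g \<subseteq> H" using Hahn_inverse_exists assms by blast
  then show ?thesis by (metis inverse_unique)
qed simp

section \<open>Characteristic p and the Frobenius map\<close>

lemma of_nat_hahn: "of_nat n = monomial (of_nat n) 0"
  for n :: nat
  by (induction n) (auto intro!: hahn_eqI simp: one_hahn_def)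

text \<open>Carries the characteristic over to series, so that the freshman's dream applies to
  them.\<close>

lemma CHAR_hahn [simp]: "CHAR('a::comm_ring_1 hahn) = CHAR('a)"
proof (rule CHAR_eqI)
  show "of_nat CHAR('a) = (0::'a hahn)" by (rule hahn_eqI) (simp add: of_nat_hahn)
  show "CHAR('a) dvd n" if "of_nat n = (0::'a hahn)" for n
  proof -
    have "coeff (of_nat n) 0 = coeff (0::'a hahn) 0" using that by simp
    then show ?thesis by (simp add: of_nat_hahn of_nat_eq_0_iff_char_dvd)
  qed
qed

text \<open>Stated for \<open>Suc n\<close> because the zeroth power is 1, whose exponent 0 violates
  the strict bound.\<close>

lemma supp_power_lessThan:
  fixes f :: "'a::comm_ring_1 hahn"
  assumes "supp f \<subseteq> {..<x}"
  shows "supp (f ^ Suc n) \<subseteq> {..<real (Suc n) * x}"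
proof (induction n)
  case 0
  show ?case using assms by simp
next
  case (Suc n)
  show ?case by (subst power_Suc, rule supp_times_subset[OF assms Suc]) (simp add: algebra_simps)
qed

lemma supp_power_greaterThan:
  fixes f :: "'a::comm_ring_1 hahn"
  assumes "supp f \<subseteq> {x<..}"
  shows "supp (f ^ Suc n) \<subseteq> {real (Suc n) * x<..}"
proof (induction n)
  case 0
  show ?case using assms by simp
next
  case (Suc n)
  show ?case by (subst power_Suc, rule supp_times_subset[OF assms Suc]) (simp add: algebra_simps)
qed

text \<open>Split \<open>f\<close> at the exponent \<open>y\<close>. By the freshman's dream only the middle monomial
  contributes to the exponent \<open>p * y\<close> of the \<open>p\<close>-th power.\<close>

lemma coeff_power_CHAR:
  fixes f :: "'a::field hahn"
  assumes p: "p = CHAR('a)" "p > 0"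
  shows "coeff (f ^ p) (real p * y) = coeff f y ^ p"
proof -
  define f1 where "f1 = restrict_supp {..<y} f"
  define f2 where "f2 = restrict_supp {y<..} f"
  have f: "f = (f1 + monomial (coeff f y) y) + f2"
    by (rule hahn_eqI) (auto simp: f1_def f2_def)
  have "prime CHAR('a hahn)" using p by (simp add: prime_CHAR_semidom)
  then have dream: "(g + h) ^ p = g ^ p + h ^ p" for g h :: "'a hahn"
    using p by (intro freshmans_dream) simp_all
  have fp: "f ^ p = (f1 ^ p + monomial (coeff f y ^ p) (real p * y)) + f2 ^ p"
    by (subst f) (simp only: dream monomial_power)
  obtain n where n: "p = Suc n" using p(2) by (metis gr0_implies_Suc)
  have "supp (f1 ^ p) \<subseteq> {..<real p * y}"
    unfolding n by (rule supp_power_lessThan) (simp add: f1_def)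
  then have "coeff (f1 ^ p) (real p * y) = 0" by (auto simp: hsupp_def)
  moreover have "supp (f2 ^ p) \<subseteq> {real p * y<..}"
    unfolding n by (rule supp_power_greaterThan) (simp add: f2_def)
  then have "coeff (f2 ^ p) (real p * y) = 0" by (auto simp: hsupp_def)
  ultimately show ?thesis unfolding fp by simp
qed

text \<open>Every real exponent has the form \<open>p * y\<close>, so
  \<open>coeff_power_CHAR\<close> determines all coefficients of the power, and in a field
  \<open>c ^ p\<close> vanishes only for \<open>c = 0\<close>.\<close>

lemma supp_power_CHAR:
  fixes f :: "'a::field hahn"
  assumes p: "p = CHAR('a)" "p > 0"
  shows "supp (f ^ p) = (\<lambda>x. real p * x) ` supp f"
proof -
  have *: "x \<in> supp (f ^ p) \<longleftrightarrow> x / real p \<in> supp f" for x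
    using coeff_power_CHAR[OF p, of f "x / real p"] p(2) by (simp add: in_supp_iff)
  show ?thesis
  proof (intro set_eqI iffI)
    fix x assume "x \<in> supp (f ^ p)"
    then show "x \<in> (\<lambda>x. real p * x) ` supp f"
      using * p(2) by (intro image_eqI[of _ _ "x / real p"]) auto
  next
    fix x assume "x \<in> (\<lambda>x. real p * x) ` supp f"
    then obtain y where "x = real p * y" "y \<in> supp f" by blast
    then show "x \<in> supp (f ^ p)" using *[of x] p(2) by simp
  qed
qed

text \<open>Exponents from the two supports add up to \<open>v + w\<close> only as \<open>v\<close>
  and \<open>w\<close> themselves. This is the multiplicativity of the valuation.\<close>

lemma coeff_times_least:
  fixes f g :: "'a::comm_ring_1 hahn"
  assumes "supp f \<subseteq> {v..}" "supp g \<subseteq> {w..}"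
  shows "coeff (f * g) (v + w) = coeff f v * coeff g w"
proof -
  have "{a \<in> supp f. v + w - a \<in> supp g} \<subseteq> {v}" using assms by fastforce
  then have "coeff (f * g) (v + w) = (\<Sum>a\<in>{v}. coeff f a * coeff g (v + w - a))"
    by (intro coeff_times_eq_sum) auto
  then show ?thesis by simp
qed

text \<open>The least exponents of \<open>f\<close> and of its inverse add up to 0, the only
  exponent of 1.\<close>

lemma supp_inverse_atLeast:
  fixes f :: "'a::field hahn"
  assumes v: "coeff f v \<noteq> 0" "supp f \<subseteq> {v..}"
  shows "supp (inverse f) \<subseteq> {- v..}"
proof -
  have "f \<noteq> 0" using v(1) by auto
  then obtain w where w: "coeff (inverse f) w \<noteq> 0" "supp (inverse f) \<subseteq> {w..}"
    using least_supp[of "inverse f"] by auto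
  have "coeff (f * inverse f) (v + w) \<noteq> 0"
    using coeff_times_least[OF v(2) w(2)] v(1) w(1) by simp
  moreover have "f * inverse f = 1" using \<open>f \<noteq> 0\<close> by simp
  ultimately have "v + w = 0" by (simp add: one_hahn_def split: if_splits)
  then show ?thesis using w(2) by (simp add: add_eq_0_iff)
qed

lemma subgroup_of_int_times:
  assumes "is_subgroup_R H" "x \<in> H"
  shows "of_int k * x \<in> H"
proof -
  have nat: "of_nat n * x \<in> H" for n
    using assms by (induction n) (auto simp: is_subgroup_R_def algebra_simps)
  show ?thesis
  proof (cases "k \<ge> 0")
    case True
    then show ?thesis using nat[of "nat k"] by simp
  next
    case False
    then have "- (of_nat (nat (- k)) * x) \<in> H" using nat assms(1) unfolding is_subgroup_R_def by blast
    then show ?thesis using False by simp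
  qed
qed

lemma subgroup_scaleset: "is_subgroup_R G \<Longrightarrow> is_subgroup_R (scaleset p G)"
  unfolding is_subgroup_R_def scaleset_def
  by (auto simp: distrib_left[symmetric] mult_minus_right[symmetric] simp del: mult_minus_right
      intro!: imageI)

lemma subgroup_diff: "is_subgroup_R G \<Longrightarrow> x \<in> G \<Longrightarrow> y \<in> G \<Longrightarrow> x - y \<in> G"
  unfolding is_subgroup_R_def by (metis add_uminus_conv_diff)

section \<open>Series supported on finitely many cosets\<close>

text \<open>The parameter \<open>K\<close> fixes the coefficient field, which occurs in neither of
  the types of \<open>G\<close> and \<open>p\<close>.\<close>

locale hahn_frobenius =
  fixes G :: "real set" and p :: nat and K :: "'a::field itself"
  assumes p_CHAR: "p = CHAR('a)" and p_pos: "p > 0" and subgroup_G: "is_subgroup_R G"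
begin

abbreviation pG :: "real set" where "pG \<equiv> scaleset p G"

lemma G_zero: "0 \<in> G" and G_plus: "x \<in> G \<Longrightarrow> y \<in> G \<Longrightarrow> x + y \<in> G"
  using subgroup_G by (auto simp: is_subgroup_R_def)

lemma subgroup_pG: "is_subgroup_R pG"
  by (rule subgroup_scaleset[OF subgroup_G])

lemma pG_zero: "0 \<in> pG" and pG_plus: "x \<in> pG \<Longrightarrow> y \<in> pG \<Longrightarrow> x + y \<in> pG"
  using subgroup_pG by (auto simp: is_subgroup_R_def)

lemma pG_subset: "pG \<subseteq> G"
  using subgroup_of_int_times[OF subgroup_G, of _ "int p"] by (auto simp: scaleset_def)

text \<open>Frobenius sends every series over \<open>G\<close> into the base field. This gives the
  inverses in \<open>fincos\<close>, its algebraicity, and the scalar action on the p-th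
  root.\<close>

lemma supp_frobenius:
  fixes f :: "'a hahn"
  assumes "supp f \<subseteq> G"
  shows "supp (f ^ p) \<subseteq> pG"
  using assms unfolding supp_power_CHAR[OF p_CHAR p_pos] scaleset_def by blast

text \<open>\<open>fincos\<close> is the field \<open>M\<close> of the theorem and \<open>fincos_closure\<close> its completion, both as
  sets of elements of the Hahn field type.\<close>

definition fincos :: "'a hahn set" where
  "fincos = {f. \<exists>R. finite R \<and> R \<subseteq> G \<and> supp f \<subseteq> (\<Union>r\<in>R. (+) r ` pG)}"

definition fincos_closure :: "'a hahn set" where
  "fincos_closure = {f. supp f \<subseteq> G \<and> (\<forall>x. \<exists>m\<in>fincos. supp (f - m) \<subseteq> {x<..})}"

lemma fincosI: "finite R \<Longrightarrow> R \<subseteq> G \<Longrightarrow> supp f \<subseteq> (\<Union>r\<in>R. (+) r ` pG) \<Longrightarrow> f \<in> fincos"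
  unfolding fincos_def by blast

lemma fincosE:
  assumes "f \<in> fincos"
  obtains R where "finite R" "R \<subseteq> G" "supp f \<subseteq> (\<Union>r\<in>R. (+) r ` pG)"
  using assms unfolding fincos_def by auto

lemma supp_fincos: "f \<in> fincos \<Longrightarrow> supp f \<subseteq> G"
proof (elim fincosE)
  fix R assume R: "R \<subseteq> G" "supp f \<subseteq> (\<Union>r\<in>R. (+) r ` pG)"
  have "(\<Union>r\<in>R. (+) r ` pG) \<subseteq> G" using R(1) pG_subset G_plus by blast
  then show "supp f \<subseteq> G" using R(2) by simp
qed

lemma fincos_coset:
  assumes "r \<in> G" "supp f \<subseteq> (+) r ` pG"
  shows "f \<in> fincos"
  by (rule fincosI[of "{r}"]) (use assms in auto)

lemma fincos_pG: "supp f \<subseteq> pG \<Longrightarrow> f \<in> fincos"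
  by (rule fincos_coset[OF G_zero]) simp

lemma fincos_monomial: "r \<in> G \<Longrightarrow> monomial a r \<in> fincos"
  by (rule fincos_coset, assumption, rule order_trans[OF supp_monomial_subset])
     (use pG_zero in force)

lemma fincos_one: "1 \<in> fincos"
  unfolding one_hahn_def by (rule fincos_monomial[OF G_zero])

lemma fincos_zero: "0 \<in> fincos"
  by (rule fincos_pG) simp

lemma fincos_plus:
  assumes "f \<in> fincos" "g \<in> fincos"
  shows "f + g \<in> fincos"
proof -
  obtain R S where R: "finite R" "R \<subseteq> G" "supp f \<subseteq> (\<Union>r\<in>R. (+) r ` pG)"
    and S: "finite S" "S \<subseteq> G" "supp g \<subseteq> (\<Union>r\<in>S. (+) r ` pG)"
    using assms by (elim fincosE)
  show ?thesis
  proof (rule fincosI[of "R \<union> S"])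
    show "supp (f + g) \<subseteq> (\<Union>r\<in>R \<union> S. (+) r ` pG)"
      using R(3) S(3) by (intro supp_plus_subset) (simp_all add: le_supI1 le_supI2)
  qed (use R S in auto)
qed

lemma fincos_uminus: "f \<in> fincos \<Longrightarrow> - f \<in> fincos"
  by (simp add: fincos_def)

lemma fincos_times:
  assumes "f \<in> fincos" "g \<in> fincos"
  shows "f * g \<in> fincos"
proof -
  obtain R S where R: "finite R" "R \<subseteq> G" "supp f \<subseteq> (\<Union>r\<in>R. (+) r ` pG)"
    and S: "finite S" "S \<subseteq> G" "supp g \<subseteq> (\<Union>r\<in>S. (+) r ` pG)"
    using assms by (elim fincosE)
  show ?thesis
  proof (rule fincosI[of "(\<lambda>(r, s). r + s) ` (R \<times> S)"])
    show "supp (f * g) \<subseteq> (\<Union>r\<in>(\<lambda>(r, s). r + s) ` (R \<times> S). (+) r ` pG)"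
    proof (rule supp_times_subset[OF R(3) S(3)])
      fix a b assume "a \<in> (\<Union>r\<in>R. (+) r ` pG)" "b \<in> (\<Union>r\<in>S. (+) r ` pG)"
      then obtain r s x y where *: "r \<in> R" "s \<in> S" "x \<in> pG" "y \<in> pG" "a = r + x" "b = s + y"
        by blast
      then have "a + b = (r + s) + (x + y)" "x + y \<in> pG" using pG_plus by auto
      then show "a + b \<in> (\<Union>r\<in>(\<lambda>(r, s). r + s) ` (R \<times> S). (+) r ` pG)"
        using *(1,2) by (intro UN_I[of "r + s"]) auto
    qed
    show "(\<lambda>(r, s). r + s) ` (R \<times> S) \<subseteq> G" using R(2) S(2) G_plus by auto
  qed (use R S in simp)
qed

lemma fincos_power: "f \<in> fincos \<Longrightarrow> f ^ n \<in> fincos"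
  by (induction n) (auto intro: fincos_one fincos_times)

text \<open>The identity \<open>inverse f = f ^ (p - 1) * inverse (f ^ p)\<close> reduces the claim
  to a series with exponents in \<open>pG\<close>, whose inverse again has exponents in
  \<open>pG\<close>.\<close>

lemma fincos_inverse:
  assumes f: "f \<in> fincos"
  shows "inverse f \<in> fincos"
proof (cases "f = 0")
  case False
  have "f * f ^ (p - 1) = f ^ p" using p_pos by (metis power_eq_if neq0_conv)
  then have "f * (f ^ (p - 1) * inverse (f ^ p)) = 1"
    using False by (simp flip: mult.assoc)
  then have "inverse f = f ^ (p - 1) * inverse (f ^ p)" by (rule inverse_unique)
  moreover have "inverse (f ^ p) \<in> fincos"
    by (intro fincos_pG supp_inverse_subset[OF subgroup_pG] supp_frobenius supp_fincos f)
  ultimately show ?thesis using fincos_times fincos_power f by simp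
qed (simp add: fincos_zero)

text \<open>Provides the minimality of \<open>fincos\<close> among the fields containing the
  generators. Induction on the set of cosets splits off the part on one coset, which is a monomial
  times a series over \<open>pG\<close>.\<close>

lemma fincos_subset_if_closed:
  assumes pG: "\<And>f. supp f \<subseteq> pG \<Longrightarrow> f \<in> S" and mon: "\<And>r. r \<in> G \<Longrightarrow> monomial 1 r \<in> S"
    and plus: "\<And>f g. f \<in> S \<Longrightarrow> g \<in> S \<Longrightarrow> f + g \<in> S"
    and times: "\<And>f g. f \<in> S \<Longrightarrow> g \<in> S \<Longrightarrow> f * g \<in> S"
  shows "fincos \<subseteq> S"
proof
  fix f assume "f \<in> fincos"
  then obtain R where "finite R" "R \<subseteq> G" "supp f \<subseteq> (\<Union>r\<in>R. (+) r ` pG)" by (elim fincosE)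
  then show "f \<in> S"
  proof (induction R arbitrary: f rule: finite_induct)
    case empty
    then show ?case by (intro pG) simp
  next
    case (insert r R)
    define g where "g = restrict_supp ((+) r ` pG) f"
    define h where "h = restrict_supp (- (+) r ` pG) f"
    have f: "f = g + h" by (rule hahn_eqI) (simp add: g_def h_def)
    have "supp h \<subseteq> (\<Union>r\<in>R. (+) r ` pG)"
      unfolding h_def supp_restrict_supp using insert.prems by auto
    then have "h \<in> S" using insert.prems by (intro insert.IH) simp_all
    moreover have "g = monomial 1 r * (monomial 1 (- r) * g)"
      by (rule hahn_eqI) simp
    moreover have "supp (monomial 1 (- r) * g) \<subseteq> pG"
      unfolding g_def
      by (rule supp_times_subset[OF supp_monomial_subset, of _ "(+) r ` pG"])
         (unfold supp_restrict_supp, auto)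
    then have "monomial 1 r * (monomial 1 (- r) * g) \<in> S"
      using insert.prems by (intro times pG mon) auto
    ultimately show ?case using plus f by metis
  qed
qed

section \<open>The completion as a field\<close>

lemma supp_closure: "f \<in> fincos_closure \<Longrightarrow> supp f \<subseteq> G"
  by (simp add: fincos_closure_def)

lemma closure_approx:
  assumes "f \<in> fincos_closure"
  obtains m where "m \<in> fincos" "supp (f - m) \<subseteq> {x<..}"
  using assms unfolding fincos_closure_def by blast

lemma fincos_subset_closure: "f \<in> fincos \<Longrightarrow> f \<in> fincos_closure"
  unfolding fincos_closure_def using supp_fincos by (auto intro!: bexI[of _ f])

lemma closure_plus:
  assumes f: "f \<in> fincos_closure" and g: "g \<in> fincos_closure"
  shows "f + g \<in> fincos_closure"
  unfolding fincos_closure_def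
proof (intro CollectI conjI allI)
  show "supp (f + g) \<subseteq> G" by (intro supp_plus_subset supp_closure f g)
  fix x
  obtain m n where "m \<in> fincos" "supp (f - m) \<subseteq> {x<..}" "n \<in> fincos" "supp (g - n) \<subseteq> {x<..}"
    using closure_approx f g by metis
  moreover have "f + g - (m + n) = (f - m) + (g - n)" by simp
  ultimately show "\<exists>m\<in>fincos. supp (f + g - m) \<subseteq> {x<..}"
    using supp_plus_subset fincos_plus by metis
qed

text \<open>The identity behind this is \<open>f * g - n * m = f * (g - n) + n * (f - m)\<close>.
  The precision required of \<open>m\<close> depends on a lower bound for \<open>supp n\<close>, so
  \<open>n\<close> is chosen first.\<close>

lemma closure_times:
  assumes f: "f \<in> fincos_closure" and g: "g \<in> fincos_closure"
  shows "f * g \<in> fincos_closure"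
  unfolding fincos_closure_def
proof (intro CollectI conjI allI)
  show "supp (f * g) \<subseteq> G" by (rule supp_times_subset[OF supp_closure[OF f] supp_closure[OF g] G_plus])
  fix x
  obtain a where a: "supp f \<subseteq> {a..}" using supp_subset_atLeast by blast
  obtain n where n: "n \<in> fincos" "supp (g - n) \<subseteq> {x - a<..}" using closure_approx[OF g] .
  obtain b where b: "supp n \<subseteq> {b..}" using supp_subset_atLeast by blast
  obtain m where m: "m \<in> fincos" "supp (f - m) \<subseteq> {x - b<..}" using closure_approx[OF f] .
  have "f * g - n * m = f * (g - n) + n * (f - m)" by (simp add: algebra_simps)
  moreover have "supp (f * (g - n)) \<subseteq> {x<..}" by (rule supp_times_subset[OF a n(2)]) auto
  moreover have "supp (n * (f - m)) \<subseteq> {x<..}" by (rule supp_times_subset[OF b m(2)]) auto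
  ultimately have "supp (f * g - n * m) \<subseteq> {x<..}" using supp_plus_subset by metis
  then show "\<exists>m\<in>fincos. supp (f * g - m) \<subseteq> {x<..}" using fincos_times n(1) m(1) by blast
qed

lemma closure_inverse:
  assumes f: "f \<in> fincos_closure"
  shows "inverse f \<in> fincos_closure"
proof (cases "f = 0")
  case False
  then obtain v where v: "coeff f v \<noteq> 0" "supp f \<subseteq> {v..}" using least_supp by blast
  show ?thesis
    unfolding fincos_closure_def
  proof (intro CollectI conjI allI)
    show "supp (inverse f) \<subseteq> G" by (rule supp_inverse_subset[OF subgroup_G supp_closure[OF f]])
    fix x
    \<comment> \<open>Precision beyond \<open>v\<close> gives \<open>m\<close> the same least
      exponent as \<open>f\<close>. The additional \<open>2 * v\<close> is lost on multiplying by
      the two inverses, each of order \<open>- v\<close>.\<close>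
    obtain m where m: "m \<in> fincos" "supp (f - m) \<subseteq> {max v (x + 2 * v)<..}"
      using closure_approx[OF f] .
    have "v \<notin> supp (f - m)" using m(2) by auto
    then have mv: "coeff m v \<noteq> 0" using v(1) by (auto simp: in_supp_iff)
    then have "m \<noteq> 0" by auto
    have "supp (f - m) \<subseteq> {v..}" using m(2) by auto
    then have "supp (f - (f - m)) \<subseteq> {v..}" by (rule supp_minus_subset[OF v(2)])
    then have "supp m \<subseteq> {v..}" by simp
    note inv = supp_inverse_atLeast[OF v] supp_inverse_atLeast[OF mv this]
    have "inverse f - inverse m = - (inverse f * ((f - m) * inverse m))"
      using False \<open>m \<noteq> 0\<close> by (simp add: field_simps)
    moreover have "supp ((f - m) * inverse m) \<subseteq> {x + v<..}"
      by (rule supp_times_subset[OF m(2) inv(2)]) auto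
    then have "supp (inverse f * ((f - m) * inverse m)) \<subseteq> {x<..}"
      by (rule supp_times_subset[OF inv(1)]) auto
    ultimately have "supp (inverse f - inverse m) \<subseteq> {x<..}" by simp
    then show "\<exists>m\<in>fincos. supp (inverse f - m) \<subseteq> {x<..}" using fincos_inverse m(1) by blast
  qed
qed (simp add: fincos_subset_closure fincos_zero)

text \<open>Up to \<open>B\<close> the series agrees with an element of \<open>fincos\<close> and so
  meets only finitely many cosets; the pigeonhole principle does the rest. This obstruction refutes
  both spherical completeness and nonzero functionals.\<close>

lemma closure_coeff_eq_zero:
  fixes s :: "nat \<Rightarrow> real"
  assumes f: "f \<in> fincos_closure" and bounded: "\<And>i. s i \<le> B"
    and distinct: "\<And>i j. i \<noteq> j \<Longrightarrow> s i - s j \<notin> pG"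
  shows "\<exists>i. coeff f (s i) = 0"
proof (rule ccontr)
  assume "\<not> ?thesis"
  then have nz: "coeff f (s i) \<noteq> 0" for i by simp
  obtain m where m: "m \<in> fincos" "supp (f - m) \<subseteq> {B<..}" using closure_approx[OF f] .
  obtain R where R: "finite R" "supp m \<subseteq> (\<Union>r\<in>R. (+) r ` pG)" using m(1) by (elim fincosE)
  have "\<exists>r\<in>R. s i - r \<in> pG" for i
  proof -
    have "s i \<notin> supp (f - m)" using m(2) bounded[of i] by auto
    then have "s i \<in> supp m" using nz[of i] by (simp add: in_supp_iff)
    then obtain r h where "r \<in> R" "h \<in> pG" "s i = r + h" using R(2) by blast
    then show ?thesis by (intro bexI[of _ r]) simp_all
  qed
  then obtain r where r: "\<And>i. r i \<in> R" "\<And>i. s i - r i \<in> pG" by metis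
  have "finite (range r)" using R(1) r(1) by (meson finite_subset image_subsetI)
  then have "\<not> inj r" using finite_imageD infinite_UNIV_nat by blast
  then obtain i j where "i \<noteq> j" "r i = r j" unfolding inj_def by blast
  then have "(s i - r i) - (s j - r j) = s i - s j" by simp
  then show False using subgroup_diff[OF subgroup_pG r(2)[of i] r(2)[of j]] distinct[OF \<open>i \<noteq> j\<close>] by simp
qed

section \<open>Bounded sequences of coset representatives\<close>

text \<open>Shifting by elements of \<open>pG\<close> does not change the coset, and integer
  multiples of a positive \<open>q\<close> in \<open>pG\<close> bring every representative into the
  interval from 0 to \<open>q\<close>.\<close>

lemma bounded_sequence:
  assumes inf: "infinite (cosets_R G pG)"
  obtains r :: "nat \<Rightarrow> real" and B where "\<And>i. r i \<in> G" "\<And>i. \<bar>r i\<bar> \<le> B"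
    "\<And>i j. i \<noteq> j \<Longrightarrow> r i - r j \<notin> pG"
proof -
  obtain c :: "nat \<Rightarrow> real set" where c: "inj c" "range c \<subseteq> cosets_R G pG"
    using infinite_countable_subset[OF inf] by blast
  define coset where "coset x = {x + h | h. h \<in> pG}" for x
  have "c i \<in> coset ` G" for i using c(2) unfolding cosets_R_def coset_def by blast
  then have "\<forall>i. \<exists>x. x \<in> G \<and> c i = coset x" by blast
  from choice[OF this] obtain x where x: "\<And>i. x i \<in> G" "\<And>i. c i = coset (x i)" by blast
  have distinct: "x i - x j \<notin> pG" if "i \<noteq> j" for i j
  proof
    assume xij: "x i - x j \<in> pG"
    have xji: "x j - x i \<in> pG"
      using xij subgroup_pG unfolding is_subgroup_R_def by (metis minus_diff_eq)
    have "y \<in> c i \<longleftrightarrow> y - x i \<in> pG" for y i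
      unfolding x(2) coset_def by (auto simp: algebra_simps intro!: exI[of _ "y - x i"])
    moreover have "y - x i \<in> pG \<longleftrightarrow> y - x j \<in> pG" for y
      using pG_plus[OF _ xij, of "y - x i"] pG_plus[OF _ xji, of "y - x j"] by auto
    ultimately have "c i = c j" by blast
    then show False using c(1) that by (simp add: inj_eq)
  qed
  \<comment> \<open>Supplies the nonzero element from which \<open>q\<close> is built; the zero
    group has only finitely many cosets.\<close>
  have "\<not> G \<subseteq> {0}"
  proof
    assume "G \<subseteq> {0}"
    then have "finite G" using finite_subset by blast
    then show False using inf unfolding cosets_R_def by simp
  qed
  then obtain g where "g \<in> G" "g \<noteq> 0" by blast
  then have "\<bar>g\<bar> \<in> G" "\<bar>g\<bar> > 0" using subgroup_G by (auto simp: is_subgroup_R_def abs_if)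
  define q where "q = real p * \<bar>g\<bar>"
  have q: "q \<in> pG" "q > 0"
    using \<open>\<bar>g\<bar> \<in> G\<close> \<open>g \<noteq> 0\<close> p_pos unfolding q_def scaleset_def by auto
  define k where "k i = of_int \<lfloor>x i / q\<rfloor> * q" for i
  have k: "k i \<in> pG" for i unfolding k_def by (rule subgroup_of_int_times[OF subgroup_pG q(1)])
  show ?thesis
  proof (rule that[of "\<lambda>i. x i - k i" q])
    show "x i - k i \<in> G" for i using subgroup_diff[OF subgroup_G x(1)] k pG_subset by blast
    show "\<bar>x i - k i\<bar> \<le> q" for i
    proof -
      have "x i - k i = frac (x i / q) * q" using q(2) by (simp add: frac_def k_def field_simps)
      moreover have "0 \<le> frac (x i / q)" "frac (x i / q) \<le> 1"
        by (auto intro: less_imp_le[OF frac_lt_1])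
      ultimately show ?thesis using q(2) mult_right_mono[of "frac (x i / q)" 1 q] by (simp add: abs_mult)
    qed
    show "x i - k i - (x j - k j) \<notin> pG" if "i \<noteq> j" for i j
    proof
      assume "x i - k i - (x j - k j) \<in> pG"
      from pG_plus[OF this subgroup_diff[OF subgroup_pG k[of i] k[of j]]]
      show False using distinct[OF that] by simp
    qed
  qed
qed

text \<open>A monotone subsequence is strictly monotone because its cosets are distinct. A
  decreasing one is negated, which preserves both the two-sided bound and the distinctness.\<close>

lemma increasing_sequence:
  assumes inf: "infinite (cosets_R G pG)"
  obtains s :: "nat \<Rightarrow> real" and B where "strict_mono s" "\<And>i. s i \<in> G" "\<And>i. s i \<le> B"
    "\<And>i j. i \<noteq> j \<Longrightarrow> s i - s j \<notin> pG"
proof -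
  obtain r :: "nat \<Rightarrow> real" and B where r: "\<And>i. r i \<in> G" "\<And>i. \<bar>r i\<bar> \<le> B"
    "\<And>i j. i \<noteq> j \<Longrightarrow> r i - r j \<notin> pG"
    using bounded_sequence[OF inf] by blast
  obtain \<phi> :: "nat \<Rightarrow> nat" where \<phi>: "strict_mono \<phi>" "monoseq (\<lambda>n. r (\<phi> n))"
    using seq_monosub by blast
  have dist: "r (\<phi> i) - r (\<phi> j) \<notin> pG" if "i \<noteq> j" for i j
    using r(3) that \<phi>(1) by (simp add: strict_mono_eq)
  then have neq: "r (\<phi> i) \<noteq> r (\<phi> j)" if "i \<noteq> j" for i j using that pG_zero by force
  have bd: "r (\<phi> i) \<le> B" "- r (\<phi> i) \<le> B" for i using r(2)[of "\<phi> i"] by auto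
  from \<phi>(2) consider "\<And>i j. i \<le> j \<Longrightarrow> r (\<phi> i) \<le> r (\<phi> j)" | "\<And>i j. i \<le> j \<Longrightarrow> r (\<phi> j) \<le> r (\<phi> i)"
    unfolding monoseq_def by blast
  then show ?thesis
  proof cases
    case 1
    have "strict_mono (\<lambda>i. r (\<phi> i))"
      by (rule strict_monoI) (metis 1 neq less_le)
    then show ?thesis using that[of "\<lambda>i. r (\<phi> i)" B] r(1) bd dist by blast
  next
    case 2
    have "strict_mono (\<lambda>i. - r (\<phi> i))"
      by (rule strict_monoI) (metis 2 neq less_le neg_less_iff_less)
    moreover have "- r (\<phi> i) - - r (\<phi> j) \<notin> pG" if "i \<noteq> j" for i j using dist[of j i] that by simp
    moreover have "- r (\<phi> i) \<in> G" for i using r(1) subgroup_G by (simp add: is_subgroup_R_def)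
    ultimately show ?thesis using that[of "\<lambda>i. - r (\<phi> i)" B] bd by blast
  qed
qed

section \<open>Continuous functionals on the p-th root\<close>

lemma closure_power_supp: "f \<in> fincos_closure \<Longrightarrow> supp (f ^ p) \<subseteq> pG"
  by (intro supp_frobenius supp_closure)

text \<open>A nonzero functional \<open>\<psi>\<close> on \<open>y K((t\<^sup>p\<^sup>G))\<close>, which is spherically complete, would make the
  closure of \<open>fincos\<close> spherically complete. The supremum \<open>\<sigma>\<close> plays the role of the operator
  norm of \<open>\<psi>\<close>. It need not be attained, hence the preimages \<open>z i\<close> of 1 of almost maximal
  order, with errors small compared to the gaps of \<open>s\<close>.\<close>

lemma functional_eq_zero:
  fixes \<psi> :: "'a hahn \<Rightarrow> 'a hahn" and s :: "nat \<Rightarrow> real"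
  assumes s: "strict_mono s" "\<And>i. s i \<in> G" "\<And>i. s i \<le> B" "\<And>i j. i \<noteq> j \<Longrightarrow> s i - s j \<notin> pG"
    and closed: "\<And>y. y \<in> fincos_closure \<Longrightarrow> \<psi> y \<in> fincos_closure"
    and additive: "\<And>x y. x \<in> fincos_closure \<Longrightarrow> y \<in> fincos_closure \<Longrightarrow> \<psi> (x + y) = \<psi> x + \<psi> y"
    and semilinear: "\<And>a y. a \<in> fincos_closure \<Longrightarrow> y \<in> fincos_closure \<Longrightarrow> \<psi> (a ^ p * y) = a * \<psi> y"
    and bounded: "\<And>y. y \<in> fincos_closure \<Longrightarrow> supp y \<subseteq> {C<..} \<Longrightarrow> supp (\<psi> y) \<subseteq> {0<..}"
    and y: "y \<in> fincos_closure"
  shows "\<psi> y = 0"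
proof (rule ccontr)
  assume nz: "\<psi> y \<noteq> 0"
  have pG_closure: "z \<in> fincos_closure" if "supp z \<subseteq> pG" for z :: "'a hahn"
    using that by (intro fincos_subset_closure fincos_pG)
  have zy: "z * y \<in> fincos_closure" if "supp z \<subseteq> pG" for z
    using closure_times[OF pG_closure[OF that] y] .
  have smul: "\<psi> (a ^ p * z * y) = a * \<psi> (z * y)" if "a \<in> fincos_closure" "supp z \<subseteq> pG" for a z
    using semilinear[OF that(1) zy[OF that(2)]] by (simp add: mult.assoc)
  have supp_ap: "supp (a ^ p * z) \<subseteq> pG" if "a \<in> fincos_closure" "supp z \<subseteq> pG" for a z
    by (rule supp_times_subset[OF closure_power_supp[OF that(1)] that(2) pG_plus])
  \<comment> \<open>Since \<open>a ^ p\<close> multiplies the value by \<open>a\<close>, a suitable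
    scalar turns any nonzero value into 1.\<close>
  have normalize: "\<psi> (inverse (\<psi> (z * y)) ^ p * z * y) = 1"
    if "supp z \<subseteq> pG" "\<psi> (z * y) \<noteq> 0" for z
    using smul[OF closure_inverse[OF closed[OF zy[OF that(1)]]] that(1)] that(2) by simp
  \<comment> \<open>The orders of preimages of 1 measure the size of \<open>\<psi>\<close>. The
    factor \<open>p\<close> appears because a scalar \<open>a\<close> acts as multiplication by
    \<open>a ^ p\<close>.\<close>
  define V where "V = {a. \<exists>z. supp z \<subseteq> pG \<and> supp z \<subseteq> {real p * a..} \<and> \<psi> (z * y) = 1}"
  obtain w where w: "supp y \<subseteq> {w..}" using supp_subset_atLeast by blast
  \<comment> \<open>Continuity bounds \<open>V\<close>: a preimage of 1 of too large order would
    have a value of positive order, but 1 has order 0.\<close>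
  have "a \<le> (C - w) / real p" if aV: "a \<in> V" for a
  proof (rule ccontr)
    assume "\<not> a \<le> (C - w) / real p"
    then have a: "C - w < real p * a" using p_pos by (simp add: field_simps)
    obtain z where z: "supp z \<subseteq> pG" "supp z \<subseteq> {real p * a..}" "\<psi> (z * y) = 1"
      using aV unfolding V_def by blast
    have "supp (z * y) \<subseteq> {C<..}" by (rule supp_times_subset[OF z(2) w]) (use a in auto)
    then have "supp (1::'a hahn) \<subseteq> {0<..}" using bounded[OF zy[OF z(1)]] z(3) by simp
    moreover have "0 \<in> supp (1::'a hahn)" by (simp add: in_supp_iff one_hahn_def)
    ultimately show False by auto
  qed
  then have V_above: "bdd_above V" by (auto simp: bdd_above_def)
  have "V \<noteq> {}"
  proof -
    have supp1: "supp (1::'a hahn) \<subseteq> pG" using supp_one_subset pG_zero by auto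
    define z where "z = inverse (\<psi> y) ^ p * 1"
    have "supp z \<subseteq> pG" unfolding z_def
      by (rule supp_ap[OF closure_inverse[OF closed[OF y]] supp1])
    moreover have "\<psi> (z * y) = 1" using normalize[OF supp1] nz unfolding z_def by simp
    moreover obtain v where "supp z \<subseteq> {v..}" using supp_subset_atLeast by blast
    then have "supp z \<subseteq> {real p * (v / real p)..}" using p_pos by simp
    ultimately show ?thesis unfolding V_def by blast
  qed
  define \<sigma> where "\<sigma> = Sup V"
  have near: "\<exists>z. supp z \<subseteq> pG \<and> supp z \<subseteq> {real p * (\<sigma> - \<delta>)..} \<and> \<psi> (z * y) = 1" if "\<delta> > 0" for \<delta>
  proof -
    have "\<sigma> - \<delta> < Sup V" using that by (simp add: \<sigma>_def)
    then obtain a where a: "a \<in> V" "\<sigma> - \<delta> < a" using less_cSupE \<open>V \<noteq> {}\<close> by blast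
    have le: "{real p * a..} \<subseteq> {real p * (\<sigma> - \<delta>)..}" using a(2) by (simp add: mult_left_mono)
    obtain z where z: "supp z \<subseteq> pG" "supp z \<subseteq> {real p * a..}" "\<psi> (z * y) = 1"
      using a(1) unfolding V_def by blast
    show ?thesis
      by (intro exI[of _ z] conjI) (rule z(1) order_trans[OF z(2) le] z(3))+
  qed
  \<comment> \<open>The operator norm estimate. If the value has order \<open>v\<close>, normalizing
    it to 1 lowers the order bound of \<open>z\<close> by \<open>p * v\<close>, so
    \<open>a - v\<close> lies in \<open>V\<close>.\<close>
  have bound: "supp (\<psi> (z * y)) \<subseteq> {a - \<sigma>..}"
    if z: "supp z \<subseteq> pG" "supp z \<subseteq> {real p * a..}" for z a
  proof (cases "\<psi> (z * y) = 0")
    case False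
    then obtain v where v: "coeff (\<psi> (z * y)) v \<noteq> 0" "supp (\<psi> (z * y)) \<subseteq> {v..}"
      using least_supp by blast
    define u where "u = inverse (\<psi> (z * y))"
    have u: "u \<in> fincos_closure" unfolding u_def by (rule closure_inverse[OF closed[OF zy[OF z(1)]]])
    have "supp (u ^ p) \<subseteq> {real p * (- v)..}"
      unfolding u_def by (intro supp_power_atLeast supp_inverse_atLeast v)
    then have "supp (u ^ p * z) \<subseteq> {real p * (a - v)..}"
      by (rule supp_times_subset[OF _ z(2)]) (simp add: algebra_simps)
    moreover have "\<psi> (u ^ p * z * y) = 1" unfolding u_def by (rule normalize[OF z(1) False])
    ultimately have "a - v \<in> V" using supp_ap[OF u z(1)] unfolding V_def by blast
    then have "a - v \<le> \<sigma>" unfolding \<sigma>_def by (rule cSup_upper[OF _ V_above])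
    then show ?thesis using v(2) by auto
  qed simp
  \<comment> \<open>Midpoints of the gaps of \<open>s\<close>. The order of \<open>z i\<close> may
    fall short of the supremum by half a gap, and \<open>t i ^ p * z i\<close> still has order at
    least \<open>p * (\<sigma> + \<tau> i)\<close>.\<close>
  define \<tau> where "\<tau> i = (s i + s (Suc i)) / 2" for i
  have s_less: "s i < s (Suc i)" for i using s(1) by (simp add: strict_mono_Suc_iff)
  have "\<forall>i. \<exists>z. supp z \<subseteq> pG \<and> supp z \<subseteq> {real p * (\<sigma> - (s (Suc i) - \<tau> i))..} \<and> \<psi> (z * y) = 1"
    using s_less by (intro allI near) (simp add: \<tau>_def field_simps)
  from choice[OF this] obtain z where z: "\<And>i. supp (z i) \<subseteq> pG"
    "\<And>i. supp (z i) \<subseteq> {real p * (\<sigma> - (s (Suc i) - \<tau> i))..}" "\<And>i. \<psi> (z i * y) = 1"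
    by blast
  \<comment> \<open>The index is shifted by one because the tolerance for \<open>z i\<close> uses
    the gap just below \<open>s (Suc i)\<close>.\<close>
  define t where "t i = monomial (1::'a) (s (Suc i))" for i
  have t: "t i \<in> fincos_closure" for i
    unfolding t_def by (intro fincos_subset_closure fincos_monomial s(2))
  \<comment> \<open>A sequence over \<open>pG\<close> such that \<open>\<psi>\<close> maps its
    multiples by \<open>y\<close> to the partial sums of the monomials \<open>t i\<close>.\<close>
  define Y where "Y n = (\<Sum>i<n. t i ^ p * z i)" for n
  have Y_pG: "supp (Y n) \<subseteq> pG" for n
    unfolding Y_def by (intro supp_sum_subset supp_ap t z(1))
  have \<psi>_Y: "\<psi> (Y n * y) = (\<Sum>i<n. t i)" for n
  proof (induction n)
    case 0
    have "0 \<in> fincos_closure" by (rule fincos_subset_closure[OF fincos_zero])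
    from additive[OF this this] have "\<psi> 0 + 0 = \<psi> 0 + \<psi> 0" by simp
    then have "\<psi> 0 = 0" by (simp only: add_left_cancel)
    then show ?case by (simp add: Y_def)
  next
    case (Suc n)
    have "\<psi> (Y (Suc n) * y) = \<psi> (Y n * y + t n ^ p * z n * y)"
      by (simp add: Y_def distrib_right)
    also have "\<dots> = \<psi> (Y n * y) + t n * \<psi> (z n * y)"
      by (simp add: additive zy Y_pG supp_ap t z smul)
    finally show ?case using Suc z(3) by simp
  qed
  have "mono (\<lambda>n. real p * (\<sigma> + \<tau> n))"
  proof (rule incseq_SucI)
    fix n
    have "\<tau> n \<le> \<tau> (Suc n)" using s_less[of n] s_less[of "Suc n"] by (simp add: \<tau>_def)
    then show "real p * (\<sigma> + \<tau> n) \<le> real p * (\<sigma> + \<tau> (Suc n))" by (simp add: mult_left_mono)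
  qed
  moreover have "supp (Y (Suc n) - Y n) \<subseteq> {real p * (\<sigma> + \<tau> n)..}" for n
  proof -
    have "supp (t n ^ p) \<subseteq> {real p * s (Suc n)}"
      unfolding t_def monomial_power by (rule supp_monomial_subset)
    then have "supp (t n ^ p * z n) \<subseteq> {real p * (\<sigma> + \<tau> n)..}"
      by (rule supp_times_subset[OF _ z(2)]) (simp add: algebra_simps)
    then show ?thesis by (simp add: Y_def)
  qed
  \<comment> \<open>Spherical completeness of the series field over \<open>pG\<close> enters here;
    its pseudo-limit keeps exponents in \<open>pG\<close>, so \<open>Z * y\<close> is in the domain
    of \<open>\<psi>\<close>.\<close>
  ultimately obtain Z where Z: "\<And>n. supp (Z - Y n) \<subseteq> {real p * (\<sigma> + \<tau> n)..}" "supp Z \<subseteq> pG"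
    using pseudo_limit[of "\<lambda>n. real p * (\<sigma> + \<tau> n)" Y pG] Y_pG by blast
  \<comment> \<open>By \<open>bound\<close>, the remainder after \<open>Suc i\<close> terms has an
    image of order at least \<open>\<tau> (Suc i)\<close>, which lies above
    \<open>s (Suc i)\<close>. So only the partial sum contributes to this coefficient.\<close>
  have "coeff (\<psi> (Z * y)) (s (Suc i)) = 1" for i
  proof -
    have ZY: "supp (Z - Y (Suc i)) \<subseteq> pG" by (rule supp_minus_subset[OF Z(2) Y_pG])
    have "Z * y = (Z - Y (Suc i)) * y + Y (Suc i) * y" by (simp add: algebra_simps)
    then have "\<psi> (Z * y) = \<psi> ((Z - Y (Suc i)) * y) + (\<Sum>j<Suc i. t j)"
      using additive[OF zy[OF ZY] zy[OF Y_pG]] \<psi>_Y by metis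
    moreover have "supp (\<psi> ((Z - Y (Suc i)) * y)) \<subseteq> {\<tau> (Suc i)..}"
      using bound[OF ZY Z(1)] by simp
    then have "coeff (\<psi> ((Z - Y (Suc i)) * y)) (s (Suc i)) = 0"
      using s_less[of "Suc i"] by (force simp: hsupp_def \<tau>_def)
    moreover have "(\<Sum>j<i. coeff (t j) (s (Suc i))) = 0"
      using s(1) by (intro sum.neutral) (auto simp: t_def strict_mono_eq)
    ultimately show ?thesis by (simp add: t_def)
  qed
  moreover have "\<exists>i. coeff (\<psi> (Z * y)) (s (Suc i)) = 0"
    by (rule closure_coeff_eq_zero[OF closed[OF zy[OF Z(2)]]]) (use s(3,4) in auto)
  ultimately show False by simp
qed

end

section \<open>Series as functions\<close>

lemma coeff_power_fun: "coeff (f ^ n) = hpow (coeff f) n"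
  by (induction n) (simp_all add: coeff_one_fun coeff_times_fun)

lemma hnorm_coeff:
  fixes f :: "'a::ab_group_add hahn"
  assumes "coeff f v \<noteq> 0" "supp f \<subseteq> {v..}"
  shows "hnorm (coeff f) = exp (- v)"
proof -
  have "(LEAST x. x \<in> supp f) = v"
    using assms by (intro Least_equality) (auto simp: in_supp_iff)
  moreover have "supp f \<noteq> {}" using assms(1) by auto
  ultimately show ?thesis by (simp add: hnorm_def)
qed

text \<open>Turns all metric conditions of the theorem into support inclusions. The zero series, of
  norm 0 and empty support, fits in.\<close>

lemma hnorm_le_iff: "hnorm (coeff f) \<le> exp (- x) \<longleftrightarrow> supp f \<subseteq> {x..}"
  and hnorm_less_iff: "hnorm (coeff f) < exp (- x) \<longleftrightarrow> supp f \<subseteq> {x<..}"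
  for f :: "'a::ab_group_add hahn"
proof -
  have "(hnorm (coeff f) \<le> exp (- x) \<longleftrightarrow> supp f \<subseteq> {x..}) \<and>
    (hnorm (coeff f) < exp (- x) \<longleftrightarrow> supp f \<subseteq> {x<..})"
  proof (cases "f = 0")
    case True
    then have "hnorm (coeff f) = 0" by (simp add: hnorm_def)
    then show ?thesis using True by simp
  next
    case False
    then obtain v where v: "coeff f v \<noteq> 0" "supp f \<subseteq> {v..}" using least_supp by blast
    have "supp f \<subseteq> {x..} \<longleftrightarrow> x \<le> v" "supp f \<subseteq> {x<..} \<longleftrightarrow> x < v"
      using v by (auto simp: in_supp_iff subset_iff)
    then show ?thesis using hnorm_coeff[OF v] by simp
  qed
  then show "hnorm (coeff f) \<le> exp (- x) \<longleftrightarrow> supp f \<subseteq> {x..}"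
    "hnorm (coeff f) < exp (- x) \<longleftrightarrow> supp f \<subseteq> {x<..}" by blast+
qed

context hahn_frobenius
begin

lemma Hsubfield_fincos: "Hsubfield G (coeff ` fincos)"
  unfolding Hsubfield_def
proof (intro conjI ballI impI)
  show "coeff ` fincos \<subseteq> Hahn G"
    unfolding Hahn_eq_image_coeff using supp_fincos by blast
  show "hzero \<in> coeff ` fincos" "hone \<in> coeff ` fincos"
    using fincos_zero fincos_one by (auto simp flip: coeff_zero_fun coeff_one_fun)
  fix f assume "f \<in> coeff ` fincos"
  then obtain f' where f: "f = coeff f'" "f' \<in> fincos" by blast
  show "hneg f \<in> coeff ` fincos"
    using f fincos_uminus by (auto simp flip: coeff_uminus_fun)
  show "\<exists>g\<in>coeff ` fincos. hmul f g = hone" if "f \<noteq> hzero"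
  proof
    have "f' \<noteq> 0" using that f by (auto simp: coeff_zero_fun)
    then have "f' * inverse f' = 1" by simp
    then show "hmul f (coeff (inverse f')) = hone"
      unfolding f coeff_times_fun[symmetric] by (simp add: coeff_one_fun)
    show "coeff (inverse f') \<in> coeff ` fincos" using fincos_inverse f(2) by blast
  qed
  fix g assume "g \<in> coeff ` fincos"
  then obtain g' where g: "g = coeff g'" "g' \<in> fincos" by blast
  show "hadd f g \<in> coeff ` fincos"
    using fincos_plus[OF f(2) g(2)] unfolding f g by (simp flip: coeff_plus_fun)
  show "hmul f g \<in> coeff ` fincos"
    using fincos_times[OF f(2) g(2)] unfolding f g by (simp flip: coeff_times_fun)
qed

lemma Hpoly_subset_fincos: "Hpoly G \<subseteq> coeff ` fincos"
proof
  fix f :: "real \<Rightarrow> 'a" assume f: "f \<in> Hpoly G"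
  then have "coeff (Abs_hahn f) = f"
    by (intro coeff_Abs_hahn finite_imp_well_ordered_set) (simp add: Hpoly_def)
  \<comment> \<open>The finite support itself serves as the set of representatives.\<close>
  moreover have "Abs_hahn f \<in> fincos"
    using f pG_zero calculation by (intro fincosI[of "hsupp f"]) (force simp: Hpoly_def)+
  ultimately show "f \<in> coeff ` fincos" by (metis imageI)
qed

text \<open>In the field \<open>hahn\<close> the relation \<open>Q * f = P\<close> gives
  \<open>f = inverse Q * P\<close>, and \<open>fincos\<close> is closed under both
  operations.\<close>

lemma Hrat_subset_fincos: "Hrat G \<subseteq> coeff ` fincos"
proof
  fix f :: "real \<Rightarrow> 'a" assume "f \<in> Hrat G"
  then obtain P Q where *: "f \<in> Hahn G" "P \<in> Hpoly G" "Q \<in> Hpoly G" "Q \<noteq> hzero" "hmul Q f = P"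
    unfolding Hrat_def by blast
  from *(1) obtain f' where f: "f = coeff f'" by (auto simp: Hahn_eq_image_coeff)
  from *(2,3) obtain P' Q' where P: "P = coeff P'" "P' \<in> fincos" and Q: "Q = coeff Q'" "Q' \<in> fincos"
    using Hpoly_subset_fincos by blast
  have "Q' \<noteq> 0" using *(4) Q by (auto simp: coeff_zero_fun)
  moreover have "Q' * f' = P'"
    using *(5) unfolding f P Q coeff_times_fun[symmetric] by (simp add: coeff_inject)
  ultimately have "f' = inverse Q' * P'" by (auto simp: field_simps)
  then show "f \<in> coeff ` fincos" using fincos_times fincos_inverse P(2) Q(2) f by blast
qed

lemma monomial_in_Hrat: "r \<in> G \<Longrightarrow> coeff (monomial a r :: 'a hahn) \<in> Hrat G"
proof -
  assume r: "r \<in> G"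
  let ?m = "monomial a r :: 'a hahn"
  have m: "supp ?m \<subseteq> {r}" and one: "supp (1 :: 'a hahn) \<subseteq> {0}"
    by (rule supp_monomial_subset supp_one_subset)+
  have "coeff ?m \<in> Hahn G" using m r by (auto simp: Hahn_eq_image_coeff)
  moreover have "coeff ?m \<in> Hpoly G" using m r finite_subset[OF m] by (auto simp: Hpoly_def)
  moreover have "coeff (1 :: 'a hahn) \<in> Hpoly G"
    using one G_zero finite_subset[OF one] by (auto simp: Hpoly_def)
  moreover have "coeff (1 :: 'a hahn) \<noteq> hzero"
    by (metis coeff_inject coeff_zero_fun one_neq_zero)
  moreover have "hmul (coeff 1) (coeff ?m) = coeff ?m" by (simp flip: coeff_times_fun)
  ultimately show ?thesis unfolding Hrat_def by blast
qed

text \<open>\<open>fincos\<close> is one of the intersected subfields, and each of them contains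
  \<open>fincos\<close> because it contains the generators.\<close>

lemma Hcompositum_eq: "Hcompositum G (Hahn pG) (Hrat G) = coeff ` fincos"
proof
  have "Hahn pG \<subseteq> coeff ` fincos"
    unfolding Hahn_eq_image_coeff using fincos_pG by blast
  then show "Hcompositum G (Hahn pG) (Hrat G) \<subseteq> coeff ` fincos"
    unfolding Hcompositum_def using Hsubfield_fincos Hrat_subset_fincos by blast
  show "coeff ` fincos \<subseteq> Hcompositum G (Hahn pG) (Hrat G)"
    unfolding Hcompositum_def
  proof (intro Inter_greatest)
    fix S :: "(real \<Rightarrow> 'a) set" assume "S \<in> {S. Hsubfield G S \<and> Hahn pG \<union> Hrat G \<subseteq> S}"
    then have S: "Hsubfield G S" "Hahn pG \<subseteq> S" "Hrat G \<subseteq> S" by auto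
    have "fincos \<subseteq> coeff -` S"
    proof (rule fincos_subset_if_closed)
      show "f \<in> coeff -` S" if "supp f \<subseteq> pG" for f
        using S(2) that unfolding Hahn_eq_image_coeff by blast
      show "monomial 1 r \<in> coeff -` S" if "r \<in> G" for r
        using S(3) monomial_in_Hrat[OF that] by blast
      show "f + g \<in> coeff -` S" "f * g \<in> coeff -` S" if "f \<in> coeff -` S" "g \<in> coeff -` S" for f g
        using S(1) that unfolding Hsubfield_def by (auto simp: coeff_plus_fun coeff_times_fun)
    qed
    then show "coeff ` fincos \<subseteq> S" by blast
  qed
qed

text \<open>The series is a root of \<open>X^p - f^p\<close>, whose constant term has exponents in
  \<open>pG\<close> by Frobenius.\<close>

lemma Halgebraic_fincos:
  assumes "f \<in> fincos"
  shows "Halgebraic (Hahn pG) (coeff f)"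
  unfolding Halgebraic_def
proof (intro exI conjI allI impI)
  define c :: "nat \<Rightarrow> 'a hahn" where "c i = (if i = 0 then - (f ^ p) else if i = p then 1 else 0)" for i
  have supp_c: "supp (c i) \<subseteq> pG" for i
    using supp_frobenius[OF supp_fincos[OF assms]] supp_one_subset pG_zero by (auto simp: c_def)
  then show "coeff (c i) \<in> Hahn pG" for i
    unfolding Hahn_eq_image_coeff by blast
  show "p \<le> p" "coeff (c p) \<noteq> hzero"
    using p_pos coeff_inject[of 1 "0::'a hahn"] by (auto simp: c_def coeff_zero_fun)
  have "(\<Sum>i\<le>p. c i * f ^ i) = (\<Sum>i\<in>{0, p}. c i * f ^ i)"
    by (rule sum.mono_neutral_right) (auto simp: c_def)
  also have "\<dots> = 0" using p_pos by (simp add: c_def)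
  finally have "coeff (\<Sum>i\<le>p. c i * f ^ i) x = 0" for x by simp
  then show "(\<lambda>x. \<Sum>i\<le>p. hmul (coeff (c i)) (hpow (coeff f) i) x) = hzero"
    by (simp add: hzero_def flip: coeff_times_fun coeff_power_fun)
qed

lemma image_fincos_eq:
  "coeff ` fincos = {f \<in> Hahn G. \<exists>F. finite F \<and> F \<subseteq> cosets_R G pG \<and> hsupp f \<subseteq> \<Union>F}"
proof (intro set_eqI iffI)
  have coset: "{x + h | h. h \<in> pG} = (+) x ` pG" for x by blast
  {
    fix f assume "f \<in> coeff ` fincos"
    then obtain f' where f: "f = coeff f'" "f' \<in> fincos" by blast
    from f(2) obtain R where R: "finite R" "R \<subseteq> G" "supp f' \<subseteq> (\<Union>r\<in>R. (+) r ` pG)"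
      by (rule fincosE)
    have "f \<in> Hahn G" using supp_fincos[OF f(2)] f(1) unfolding Hahn_eq_image_coeff by blast
    moreover have "(\<lambda>r. (+) r ` pG) ` R \<subseteq> cosets_R G pG"
      using R(2) unfolding cosets_R_def coset by blast
    ultimately show "f \<in> {f \<in> Hahn G. \<exists>F. finite F \<and> F \<subseteq> cosets_R G pG \<and> hsupp f \<subseteq> \<Union>F}"
      using R(1,3) f(1) by (intro CollectI conjI exI[of _ "(\<lambda>r. (+) r ` pG) ` R"]) auto
  next
    fix f :: "real \<Rightarrow> 'a"
    assume "f \<in> {f \<in> Hahn G. \<exists>F. finite F \<and> F \<subseteq> cosets_R G pG \<and> hsupp f \<subseteq> \<Union>F}"
    then obtain F where F: "f \<in> Hahn G" "finite F" "F \<subseteq> (\<lambda>r. (+) r ` pG) ` G" "hsupp f \<subseteq> \<Union>F"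
      unfolding cosets_R_def coset by blast
    \<comment> \<open>Passes from finitely many cosets to finitely many representatives.\<close>
    obtain R where R: "R \<subseteq> G" "finite R" "F = (\<lambda>r. (+) r ` pG) ` R"
      using finite_subset_image[OF F(2,3)] by blast
    obtain f' where f: "f = coeff f'" using F(1) by (auto simp: Hahn_eq_image_coeff)
    have "f' \<in> fincos" using R F(4) unfolding f by (intro fincosI[of R]) auto
    then show "f \<in> coeff ` fincos" using f by blast
  }
qed

text \<open>Every positive \<open>\<epsilon>\<close> is \<open>exp (- x)\<close> for
  \<open>x = - ln \<epsilon>\<close>, so closeness in norm becomes agreement up to an arbitrary
  exponent.\<close>

lemma Hclosure_fincos: "Hclosure G (coeff ` fincos) = coeff ` fincos_closure"
proof -
  have ball_exp: "(\<forall>\<epsilon>>0. \<exists>m\<in>fincos. hnorm (coeff (f - m)) < \<epsilon>) \<longleftrightarrow>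
      (\<forall>x. \<exists>m\<in>fincos. supp (f - m) \<subseteq> {x<..})" for f :: "'a hahn"
  proof -
    have "(\<forall>\<epsilon>>0. \<exists>m\<in>fincos. hnorm (coeff (f - m)) < \<epsilon>) \<longleftrightarrow>
        (\<forall>x. \<exists>m\<in>fincos. hnorm (coeff (f - m)) < exp (- x))"
    proof (intro iffI allI impI)
      fix \<epsilon> :: real assume "\<forall>x. \<exists>m\<in>fincos. hnorm (coeff (f - m)) < exp (- x)" "\<epsilon> > 0"
      from this(1)[rule_format, of "- ln \<epsilon>"] this(2)
      show "\<exists>m\<in>fincos. hnorm (coeff (f - m)) < \<epsilon>" by simp
    qed simp
    then show ?thesis unfolding hnorm_less_iff .
  qed
  have "coeff f \<in> Hclosure G (coeff ` fincos) \<longleftrightarrow> f \<in> fincos_closure" for f :: "'a hahn"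
    unfolding Hclosure_def fincos_closure_def ball_exp[symmetric]
    by (simp add: Hahn_def well_ordered_supp coeff_minus_fun)
  moreover have "Hclosure G (coeff ` fincos) \<subseteq> range coeff"
    unfolding Hclosure_def Hahn_eq_image_coeff by blast
  ultimately show ?thesis by blast
qed

section \<open>Failure of spherical completeness and absence of functionals\<close>

text \<open>The disks are centred at the partial sums of the monomials \<open>t^(s i)\<close>, and
  their radii stay away from 0 because \<open>s\<close> is bounded. A common point would have
  coefficient 1 at every \<open>s i\<close>.\<close>

lemma not_spherically_complete:
  assumes inf: "infinite (cosets_R G pG)"
  shows "\<not> Hspherically_complete (coeff ` fincos_closure)"
proof
  assume sc: "Hspherically_complete (coeff ` fincos_closure)"
  obtain s :: "nat \<Rightarrow> real" and B where s: "strict_mono s" "\<And>i. s i \<in> G" "\<And>i. s i \<le> B" "\<And>i j. i \<noteq> j \<Longrightarrow> s i - s j \<notin> pG"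
    using increasing_sequence[OF inf] by blast
  define c :: "nat \<Rightarrow> 'a hahn" where "c n = (\<Sum>i<n. monomial 1 (s i))" for n
  have "c n \<in> fincos" for n
    unfolding c_def by (induction n) (auto intro: fincos_zero fincos_plus fincos_monomial s(2))
  then have c: "c n \<in> fincos_closure" for n by (rule fincos_subset_closure)
  have disk: "coeff f \<in> Hdisk (coeff ` fincos_closure) (coeff (c n)) (exp (- s n)) \<longleftrightarrow>
      f \<in> fincos_closure \<and> supp (f - c n) \<subseteq> {s n..}" for f n
    unfolding Hdisk_def mem_Collect_eq coeff_minus_fun[symmetric] hnorm_le_iff
    by (auto simp: coeff_inject)
  have "Hdisk (coeff ` fincos_closure) (coeff (c (Suc n))) (exp (- s (Suc n)))
      \<subseteq> Hdisk (coeff ` fincos_closure) (coeff (c n)) (exp (- s n))" for n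
  proof
    fix g assume g: "g \<in> Hdisk (coeff ` fincos_closure) (coeff (c (Suc n))) (exp (- s (Suc n)))"
    then obtain f where f: "g = coeff f" unfolding Hdisk_def by blast
    have "supp (f - c (Suc n)) \<subseteq> {s (Suc n)..}" using g unfolding f disk by blast
    moreover have "s n \<le> s (Suc n)" using s(1) by (simp add: strict_mono_less_eq)
    ultimately have "supp (f - c (Suc n)) \<subseteq> {s n..}" by auto
    \<comment> \<open>The centres \<open>c (Suc n)\<close> and \<open>c n\<close> differ by a
      monomial of exponent \<open>s n\<close>, just within the radius of the larger disk.\<close>
    moreover have "supp (monomial (1::'a) (s n)) \<subseteq> {s n..}"
      using supp_monomial_subset by fastforce
    ultimately have "supp (f - c (Suc n) + monomial 1 (s n)) \<subseteq> {s n..}" by (rule supp_plus_subset)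
    moreover have "f - c n = f - c (Suc n) + monomial 1 (s n)" by (simp add: c_def)
    ultimately have "supp (f - c n) \<subseteq> {s n..}" by metis
    then show "g \<in> Hdisk (coeff ` fincos_closure) (coeff (c n)) (exp (- s n))"
      using g unfolding f disk by blast
  qed
  moreover have "coeff (c n) \<in> coeff ` fincos_closure \<and> 0 < exp (- s n)" for n
    using c by simp
  ultimately have "(\<Inter>n. Hdisk (coeff ` fincos_closure) (coeff (c n)) (exp (- s n))) \<noteq> {}"
    using sc[unfolded Hspherically_complete_def, rule_format,
        of "\<lambda>n. coeff (c n)" "\<lambda>n. exp (- s n)"] by blast
  then obtain g where g: "\<And>n. g \<in> Hdisk (coeff ` fincos_closure) (coeff (c n)) (exp (- s n))"
    by blast
  then obtain f where f: "g = coeff f" unfolding Hdisk_def by blast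
  have fc: "f \<in> fincos_closure" "\<And>n. supp (f - c n) \<subseteq> {s n..}" using g unfolding f disk by blast+
  have "coeff f (s i) = 1" for i
  proof -
    have "s i < s (Suc i)" using s(1) by (simp add: strict_mono_Suc_iff)
    then have "s i \<notin> supp (f - c (Suc i))" using fc(2)[of "Suc i"] by auto
    then have "coeff f (s i) = (\<Sum>j<i. coeff (monomial 1 (s j)) (s i)) + 1"
      by (simp add: in_supp_iff c_def)
    moreover have "(\<Sum>j<i. coeff (monomial (1::'a) (s j)) (s i)) = 0"
      using s(1) by (intro sum.neutral) (auto simp: strict_mono_eq)
    ultimately show ?thesis by simp
  qed
  then show False using closure_coeff_eq_zero[OF fc(1) s(3,4)] by auto
qed

lemma no_dual_map:
  assumes inf: "infinite (cosets_R G pG)"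
  shows "\<not> root_dual_map p (coeff ` fincos_closure) \<psi>"
proof
  assume *: "root_dual_map p (coeff ` fincos_closure) \<psi>"
  obtain s :: "nat \<Rightarrow> real" and B where s: "strict_mono s" "\<And>i. s i \<in> G" "\<And>i. s i \<le> B" "\<And>i j. i \<noteq> j \<Longrightarrow> s i - s j \<notin> pG"
    using increasing_sequence[OF inf] by blast
  have "\<forall>y\<in>fincos_closure. \<exists>z\<in>fincos_closure. \<psi> (coeff y) = coeff z"
    using * unfolding root_dual_map_def by blast
  \<comment> \<open>\<open>\<phi>\<close> is \<open>\<psi>\<close> transported to the type
    \<open>hahn\<close>, where \<open>functional_eq_zero\<close> applies.\<close>
  then obtain \<phi> where \<phi>: "\<And>y. y \<in> fincos_closure \<Longrightarrow> \<phi> y \<in> fincos_closure"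
    "\<And>y. y \<in> fincos_closure \<Longrightarrow> \<psi> (coeff y) = coeff (\<phi> y)"
    by metis
  have add: "\<phi> (x + y) = \<phi> x + \<phi> y" if "x \<in> fincos_closure" "y \<in> fincos_closure" for x y
  proof -
    have "\<psi> (hadd (coeff x) (coeff y)) = hadd (\<psi> (coeff x)) (\<psi> (coeff y))"
      using * that unfolding root_dual_map_def by blast
    then show ?thesis
      using that closure_plus[OF that] by (simp add: \<phi>(2) coeff_inject flip: coeff_plus_fun)
  qed
  have smul: "\<phi> (a ^ p * y) = a * \<phi> y" if "a \<in> fincos_closure" "y \<in> fincos_closure" for a y
  proof -
    have "a ^ p \<in> fincos_closure"
      by (intro fincos_subset_closure fincos_pG closure_power_supp that)
    then have ay: "a ^ p * y \<in> fincos_closure" using closure_times that(2) by blast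
    have "\<psi> (root_smul p (coeff a) (coeff y)) = hmul (coeff a) (\<psi> (coeff y))"
      using * that unfolding root_dual_map_def by blast
    then show ?thesis
      using that ay unfolding root_smul_def
      by (simp add: \<phi>(2) coeff_inject flip: coeff_times_fun coeff_power_fun)
  qed
  have zero: "0 \<in> fincos_closure" by (rule fincos_subset_closure[OF fincos_zero])
  have "\<phi> 0 + 0 = \<phi> 0 + \<phi> 0" using add[OF zero zero] by simp
  then have \<phi>0: "\<phi> 0 = 0" by (simp only: add_left_cancel)
  \<comment> \<open>Continuity is used at 0 with \<open>\<epsilon> = 1\<close> and then rephrased as
    a bound on orders.\<close>
  have "\<exists>\<delta>>0. \<forall>y\<in>coeff ` fincos_closure. root_norm p (hsub y (coeff 0)) < \<delta> \<longrightarrow>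
      hnorm (hsub (\<psi> y) (\<psi> (coeff 0))) < 1"
    using * zero unfolding root_dual_map_def by (meson imageI zero_less_one)
  then obtain \<delta> where \<delta>: "\<delta> > 0" "\<And>y. y \<in> fincos_closure \<Longrightarrow> hnorm (coeff y) powr (1 / real p) < \<delta>
      \<Longrightarrow> hnorm (coeff (\<phi> y)) < 1"
    by (auto simp: \<phi>(2) zero \<phi>0 root_norm_def simp flip: coeff_minus_fun)
  \<comment> \<open>Chosen so that \<open>exp (- C) powr (1 / p) = \<delta>\<close>, which absorbs
    the p-th root in \<open>root_norm\<close>.\<close>
  define C where "C = - (real p * ln \<delta>)"
  have bounded: "supp (\<phi> y) \<subseteq> {0<..}" if y: "y \<in> fincos_closure" "supp y \<subseteq> {C<..}" for y
  proof -
    have "hnorm (coeff y) < exp (- C)" using y(2) by (simp add: hnorm_less_iff)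
    moreover have "0 \<le> hnorm (coeff y)" by (simp add: hnorm_def)
    ultimately have "hnorm (coeff y) powr (1 / real p) < exp (- C) powr (1 / real p)"
      using p_pos by (intro powr_less_mono2) auto
    also have "\<dots> = \<delta>" using p_pos \<delta>(1) by (simp add: C_def powr_def)
    finally have "hnorm (coeff (\<phi> y)) < exp (- 0)" using \<delta>(2)[OF y(1)] by simp
    then show ?thesis by (simp only: hnorm_less_iff)
  qed
  have "\<phi> y = 0" if "y \<in> fincos_closure" for y
    by (rule functional_eq_zero[of s B \<phi> C]) (use s \<phi>(1) add smul bounded that in auto)
  moreover obtain y where "y \<in> fincos_closure" "\<psi> (coeff y) \<noteq> hzero"
    using * unfolding root_dual_map_def by blast
  ultimately show False by (simp add: \<phi>(2) coeff_zero_fun)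
qed

end

theorem mainTheorem7:
  fixes G :: "real set" and p :: nat
  assumes char: "CHAR('a::field) = p" and ppos: "p > 0"
    and sub: "is_subgroup_R G"
    and inf: "infinite (cosets_R G (scaleset p G))"
  defines "L \<equiv> (Hahn (scaleset p G) :: (real \<Rightarrow> 'a) set)"
    and "M \<equiv> Hcompositum G (Hahn (scaleset p G)) (Hrat G)"
  shows "(\<exists>r :: nat \<Rightarrow> real. (\<forall>i. r i \<in> G) \<and> (\<exists>B. \<forall>i. \<bar>r i\<bar> \<le> B)
            \<and> (\<forall>i j. i \<noteq> j \<longrightarrow> r i - r j \<notin> scaleset p G))
    \<and> (L \<subseteq> M \<and> (\<forall>f\<in>M. Halgebraic L f)
       \<and> M = {f \<in> Hahn G. \<exists>F. finite F \<and> F \<subseteq> cosets_R G (scaleset p G) \<and> hsupp f \<subseteq> \<Union>F})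
    \<and> \<not> Hspherically_complete (Hclosure G M)
    \<and> \<not> (\<exists>\<psi>. root_dual_map p (Hclosure G M) \<psi>)"
proof -
  interpret hahn_frobenius G p "TYPE('a)"
    using char ppos sub by unfold_locales auto
  have M: "M = coeff ` fincos" unfolding M_def by (rule Hcompositum_eq)
  have "\<exists>r :: nat \<Rightarrow> real. (\<forall>i. r i \<in> G) \<and> (\<exists>B. \<forall>i. \<bar>r i\<bar> \<le> B)
            \<and> (\<forall>i j. i \<noteq> j \<longrightarrow> r i - r j \<notin> scaleset p G)"
    using bounded_sequence[OF inf] by metis
  moreover have "L \<subseteq> M"
    unfolding L_def M Hahn_eq_image_coeff using fincos_pG by blast
  moreover have "\<forall>f\<in>M. Halgebraic L f"
    unfolding L_def M using Halgebraic_fincos by blast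
  moreover have "M = {f \<in> Hahn G. \<exists>F. finite F \<and> F \<subseteq> cosets_R G (scaleset p G) \<and> hsupp f \<subseteq> \<Union>F}"
    unfolding M by (rule image_fincos_eq)
  moreover have "Hclosure G M = coeff ` fincos_closure"
    unfolding M by (rule Hclosure_fincos)
  ultimately show ?thesis
    using not_spherically_complete[OF inf] no_dual_map[OF inf] by simp
qed

end
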